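(* Let $\rho$ and $\sigma$ be two faithful states (invertible density matrices) on $\mathcal{M}$. Let $\mathcal{E}_\tau$ be the tracial conditional expectation onto a von Neumann subalgebra $\mathcal{N}$ of $\mathcal{M}$, and let $\rho_{\mathcal{N}} = \mathcal{E}_\tau(\rho)$ and $\sigma_{\mathcal{N}} = \mathcal{E}_\tau(\sigma)$. Then $$S(\rho||\sigma) - S(\rho_{\mathcal{N}}||\sigma_{\mathcal{N}}) \ \geq\ \left(\frac{\pi}{8}\right)^{4} \|\Delta_{\sigma,\rho}\|^{-2}\, \|\rho_{\mathcal{N}}\|^{-2}\,\|\sigma_{\mathcal{N}}^{-1}\|^{-2}\, \big\| \mathcal{R}_\sigma(\rho_{\mathcal{N}}) -\rho\big\|_1^4 .$$
   Context: $\mathcal{M}$ is a finite dimensional von Neumann algebra, regarded as a unital $*$-subalgebra of $M_n(\mathbb{C})$; $\mathrm{Tr}$ is the trace on $M_n(\mathbb{C})$, $\mathbf{1}$ is the identity, and $\langle X,Y\rangle_{HS}=\mathrm{Tr}[X^*Y]$. The trace norm is $\|A\|_1=\mathrm{Tr}[(A^*A)^{1/2}]$ and $\|\cdot\|$ without subscript is the operator norm. A von Neumann subalgebra $\mathcal{N}\subset\mathcal{M}$ is a $*$-subalgebra containing $\mathbf{1}$. States on $\mathcal{M}$ are identified with density matrices $\rho\in\mathcal{M}$ ($\rho\ge 0$, $\mathrm{Tr}[\rho]=1$) through $\rho(X)=\mathrm{Tr}[\rho X]$; the state is faithful iff $\rho$ is invertible. The tracial conditional expectation $\mathcal{E}_\tau:\mathcal{M}\to\mathcal{N}$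 is the orthogonal projection of $\mathcal{M}$ onto $\mathcal{N}$ with respect to $\langle\cdot,\cdot\rangle_{HS}$. The Umegaki relative entropy is $S(\rho||\sigma)=\mathrm{Tr}[\rho(\log\rho-\log\sigma)]$. The relative modular operator is $\Delta_{\sigma,\rho}(X)=\sigma X\rho^{-1}$ on $\mathcal{M}$, and $\|\Delta_{\sigma,\rho}\|$ is its operator norm on $(\mathcal{M},\langle\cdot,\cdot\rangle_{HS})$. The Petz recovery map $\mathcal{R}_\sigma:\mathcal{N}\to\mathcal{M}$ is $\mathcal{R}_\sigma(\gamma)=\sigma^{1/2}\sigma_{\mathcal{N}}^{-1/2}\gamma\sigma_{\mathcal{N}}^{-1/2}\sigma^{1/2}$. *)

theory Defs
  imports "HOL-Analysis.Analysis"
begin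

text \<open>\<open>M\<^sub>n(\<complex>)\<close> is the type \<open>complex^'n^'n\<close> with \<open>n = CARD('n)\<close>.\<close>

definition adjoint_mat :: "complex^'n^'m \<Rightarrow> complex^'m^'n" where
  "adjoint_mat A = (\<chi> i j. cnj (A $ j $ i))"

definition cinner_vec :: "complex^'n \<Rightarrow> complex^'n \<Rightarrow> complex" where
  "cinner_vec v w = (\<Sum>i\<in>UNIV. cnj (v $ i) * w $ i)"

definition hs_inner :: "complex^'n^'n \<Rightarrow> complex^'n^'n \<Rightarrow> complex" where
  "hs_inner X Y = trace (adjoint_mat X ** Y)"

definition hs_norm :: "complex^'n^'n \<Rightarrow> real" where
  "hs_norm X = sqrt (Re (hs_inner X X))"

definition hermitian_mat :: "complex^'n^'n \<Rightarrow> bool" where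
  "hermitian_mat A \<longleftrightarrow> adjoint_mat A = A"

definition psd_mat :: "complex^'n^'n \<Rightarrow> bool" where
  "psd_mat A \<longleftrightarrow> (\<forall>v. cinner_vec v (A *v v) \<in> \<real>\<^sub>\<ge>\<^sub>0)"

definition orth_proj :: "('a \<Rightarrow> 'a \<Rightarrow> complex) \<Rightarrow> 'a set \<Rightarrow> 'a \<Rightarrow> 'a::ab_group_add" where
  "orth_proj ip S x = (THE y. y \<in> S \<and> (\<forall>z\<in>S. ip z (x - y) = 0))"


subsection \<open>Functional calculus for Hermitian matrices\<close>

definition eigenspace :: "complex^'n^'n \<Rightarrow> real \<Rightarrow> (complex^'n) set" where
  "eigenspace A l = {v. A *v v = complex_of_real l *s v}"

definition real_spectrum :: "complex^'n^'n \<Rightarrow> real set" where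
  "real_spectrum A = {l. eigenspace A l \<noteq> {0}}"

text \<open>\<open>f(A) = \<Sum>\<^sub>\<lambda> f(\<lambda>) P\<^sub>\<lambda>\<close>, where \<open>P\<^sub>\<lambda>\<close> is the spectral projection of \<open>A\<close> for the
  eigenvalue \<open>\<lambda>\<close>.  Meaningful for Hermitian \<open>A\<close> only, where all eigenvalues are real.\<close>

definition mat_fun :: "(real \<Rightarrow> real) \<Rightarrow> complex^'n^'n \<Rightarrow> complex^'n^'n" where
  "mat_fun f A = (\<Sum>l\<in>real_spectrum A. f l *\<^sub>R matrix (orth_proj cinner_vec (eigenspace A l)))"

definition mat_powr :: "complex^'n^'n \<Rightarrow> real \<Rightarrow> complex^'n^'n" where
  "mat_powr A p = mat_fun (\<lambda>x. x powr p) A"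

definition mat_log :: "complex^'n^'n \<Rightarrow> complex^'n^'n" where
  "mat_log A = mat_fun ln A"


subsection \<open>Norms\<close>

definition op_norm :: "complex^'n^'n \<Rightarrow> real" where
  "op_norm A = onorm (\<lambda>v. A *v v)"

definition trace_norm :: "complex^'n^'n \<Rightarrow> real" where
  "trace_norm A = Re (trace (mat_powr (adjoint_mat A ** A) (1/2)))"

definition hs_op_norm_on ::
    "(complex^'n^'n) set \<Rightarrow> (complex^'n^'n \<Rightarrow> complex^'n^'n) \<Rightarrow> real" where
  "hs_op_norm_on M T = (SUP X\<in>M - {0}. hs_norm (T X) / hs_norm X)"


subsection \<open>Algebras, states and conditional expectations\<close>

definition von_neumann_algebra :: "(complex^'n^'n) set \<Rightarrow> bool" where
  "von_neumann_algebra M \<longleftrightarrow>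
     mat 1 \<in> M \<and>
     (\<forall>X\<in>M. \<forall>Y\<in>M. X + Y \<in> M) \<and>
     (\<forall>c. \<forall>X\<in>M. (\<chi> i j. c * X $ i $ j) \<in> M) \<and>
     (\<forall>X\<in>M. \<forall>Y\<in>M. X ** Y \<in> M) \<and>
     (\<forall>X\<in>M. adjoint_mat X \<in> M)"

definition von_neumann_subalgebra ::
    "(complex^'n^'n) set \<Rightarrow> (complex^'n^'n) set \<Rightarrow> bool" where
  "von_neumann_subalgebra N M \<longleftrightarrow> von_neumann_algebra N \<and> N \<subseteq> M"

text \<open>States are identified with their density matrices with respect to the trace.\<close>

definition faithful_state :: "(complex^'n^'n) set \<Rightarrow> complex^'n^'n \<Rightarrow> bool" where
  "faithful_state M \<rho> \<longleftrightarrow> \<rho> \<in> M \<and> psd_mat \<rho> \<and> trace \<rho> = 1 \<and> invertible \<rho>"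

definition cond_exp_tr :: "(complex^'n^'n) set \<Rightarrow> complex^'n^'n \<Rightarrow> complex^'n^'n" where
  "cond_exp_tr N X = orth_proj hs_inner N X"


subsection \<open>Relative entropy, relative modular operator and Petz recovery\<close>

text \<open>The trace below is real for Hermitian arguments, so \<open>Re\<close> discards nothing.\<close>

definition relative_entropy :: "complex^'n^'n \<Rightarrow> complex^'n^'n \<Rightarrow> real" where
  "relative_entropy \<rho> \<sigma> = Re (trace (\<rho> ** (mat_log \<rho> - mat_log \<sigma>)))"

definition rel_modular ::
    "complex^'n^'n \<Rightarrow> complex^'n^'n \<Rightarrow> complex^'n^'n \<Rightarrow> complex^'n^'n" where
  "rel_modular \<sigma> \<rho> X = \<sigma> ** X ** matrix_inv \<rho>"

definition petz_recovery ::
    "(complex^'n^'n) set \<Rightarrow> complex^'n^'n \<Rightarrow> complex^'n^'n \<Rightarrow> complex^'n^'n" where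
  "petz_recovery N \<sigma> \<gamma> =
     mat_powr \<sigma> (1/2) ** mat_powr (cond_exp_tr N \<sigma>) (-1/2) ** \<gamma>
       ** mat_powr (cond_exp_tr N \<sigma>) (-1/2) ** mat_powr \<sigma> (1/2)"


subsection \<open>The definitions above are well-behaved\<close>

lemma hs_inner_sum: "hs_inner X Y = (\<Sum>j\<in>UNIV. \<Sum>i\<in>UNIV. cnj (X $ i $ j) * Y $ i $ j)"
  by (simp add: hs_inner_def trace_def adjoint_mat_def matrix_matrix_mult_def)

lemma Re_hs_inner: "Re (hs_inner X Y) = X \<bullet> Y"
  unfolding hs_inner_sum inner_vec_def inner_complex_def
  by (subst sum.swap) simp

lemma hs_norm_eq_norm: "hs_norm X = norm X"
  by (simp add: hs_norm_def Re_hs_inner norm_eq_sqrt_inner)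

lemma Re_cinner_vec: "Re (cinner_vec v w) = v \<bullet> w"
  by (simp add: cinner_vec_def inner_vec_def inner_complex_def)

lemma orth_proj_characterization:
  fixes ip :: "'a::euclidean_space \<Rightarrow> 'a \<Rightarrow> complex" and S :: "'a set" and J :: "'a \<Rightarrow> 'a"
  assumes Re: "\<And>x y. Re (ip x y) = x \<bullet> y"
    and Im: "\<And>x y. Im (ip x y) = Re (ip (J x) y)"
    and S: "subspace S" and J: "\<And>x. x \<in> S \<Longrightarrow> J x \<in> S"
  shows "orth_proj ip S x = y \<longleftrightarrow> y \<in> S \<and> (\<forall>z\<in>S. ip z (x - y) = 0)"
proof -
  have eq: "(\<forall>z\<in>S. ip z w = 0) \<longleftrightarrow> (\<forall>z\<in>S. z \<bullet> w = 0)" for w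
    using Re Im J by (auto simp: complex_eq_iff)
  obtain y0 z0 where 1: "y0 \<in> span S" "\<And>w. w \<in> span S \<Longrightarrow> orthogonal z0 w" "x = y0 + z0"
    using orthogonal_subspace_decomp_exists[of S x] by metis
  have sp: "span S = S" using S by simp
  have y0: "y0 \<in> S" "\<forall>z\<in>S. z \<bullet> (x - y0) = 0"
    using 1 by (auto simp: sp orthogonal_def inner_commute)
  have uniq: "y = y'" if "y \<in> S" "\<forall>z\<in>S. z \<bullet> (x - y) = 0" "y' \<in> S" "\<forall>z\<in>S. z \<bullet> (x - y') = 0" for y y'
  proof -
    have "y - y' \<in> S" using S that by (simp add: subspace_diff)
    then have "(y - y') \<bullet> (x - y) = 0" "(y - y') \<bullet> (x - y') = 0" using that by auto
    then have "(y - y') \<bullet> (y - y') = 0" by (simp add: inner_diff_right)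
    then show ?thesis by simp
  qed
  have "orth_proj ip S x = y0"
    unfolding orth_proj_def eq by (rule the_equality) (use y0 uniq in blast)+
  then show ?thesis unfolding eq using y0 uniq by blast
qed

lemma von_neumann_algebra_subspace:
  assumes "von_neumann_algebra N" shows "subspace N"
proof -
  have sc: "(\<chi> i j. c * X $ i $ j) \<in> N" if "X \<in> N" for c X
    using assms that by (auto simp: von_neumann_algebra_def)
  have "c *\<^sub>R X \<in> N" if "X \<in> N" for c X
  proof -
    have "c *\<^sub>R X = (\<chi> i j. complex_of_real c * X $ i $ j)"
      by (simp add: vec_eq_iff scaleR_conv_of_real[where 'a = complex])
    with sc[OF that] show ?thesis by simp
  qed
  moreover from this[of "mat 1" 0] have "0 \<in> N"
    using assms by (simp add: von_neumann_algebra_def)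
  ultimately show ?thesis
    using assms by (simp add: subspace_def von_neumann_algebra_def)
qed

lemma cond_exp_tr_characterization:
  assumes "von_neumann_algebra N"
  shows "cond_exp_tr N X = Y \<longleftrightarrow> Y \<in> N \<and> (\<forall>Z\<in>N. hs_inner Z (X - Y) = 0)"
  unfolding cond_exp_tr_def
proof (rule orth_proj_characterization[where J = "\<lambda>X. (\<chi> i j. \<i> * X $ i $ j)"])
  show "Im (hs_inner X Y) = Re (hs_inner (\<chi> i j. \<i> * X $ i $ j) Y)" for X Y :: "complex^'a^'a"
    by (simp add: hs_inner_sum)
qed (use assms in \<open>auto simp: Re_hs_inner von_neumann_algebra_subspace von_neumann_algebra_def\<close>)

lemma scaleR_eq_smult: "a *\<^sub>R v = complex_of_real a *s v"
  by (simp add: vec_eq_iff scaleR_conv_of_real[where 'a = complex])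

lemma eigenspace_scale: "v \<in> eigenspace A l \<Longrightarrow> c *s v \<in> eigenspace A l"
  by (auto simp: eigenspace_def vector_scalar_commute mult.commute)

lemma eigenspace_subspace: "subspace (eigenspace A l)"
  unfolding subspace_def scaleR_eq_smult
  using eigenspace_scale by (auto simp: eigenspace_def matrix_vector_right_distrib vector_add_ldistrib)

lemma orth_proj_eigenspace:
  "orth_proj cinner_vec (eigenspace A l) v = w \<longleftrightarrow>
     w \<in> eigenspace A l \<and> (\<forall>z\<in>eigenspace A l. cinner_vec z (v - w) = 0)"
proof (rule orth_proj_characterization[where J = "\<lambda>v. \<i> *s v"])
  show "Im (cinner_vec x y) = Re (cinner_vec (\<i> *s x) y)" for x y :: "complex^'a"
    by (simp add: cinner_vec_def)
qed (auto simp: Re_cinner_vec eigenspace_subspace eigenspace_scale)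

lemma cinner_vec_simps:
  "cinner_vec z (v + w) = cinner_vec z v + cinner_vec z w"
  "cinner_vec z (v - w) = cinner_vec z v - cinner_vec z w"
  "cinner_vec z (c *s w) = c * cinner_vec z w"
  "cinner_vec (c *s z) w = cnj c * cinner_vec z w"
  by (simp_all add: cinner_vec_def sum.distrib sum_subtractf sum_distrib_left ring_distribs mult_ac)

lemma cinner_vec_adjoint: "cinner_vec v (A *v w) = cinner_vec (adjoint_mat A *v v) w"
  unfolding cinner_vec_def adjoint_mat_def matrix_vector_mult_def
  by (simp add: sum_distrib_left sum_distrib_right mult_ac) (rule sum.swap)

lemma eigenspaces_orthogonal:
  assumes "hermitian_mat A" "v \<in> eigenspace A l" "w \<in> eigenspace A m" "l \<noteq> m"
  shows "cinner_vec v w = 0"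
proof -
  have "complex_of_real m * cinner_vec v w = cinner_vec v (A *v w)"
    using assms by (simp add: eigenspace_def cinner_vec_simps(3))
  also have "\<dots> = complex_of_real l * cinner_vec v w"
    unfolding cinner_vec_adjoint
    using assms by (simp add: hermitian_mat_def eigenspace_def cinner_vec_simps(4))
  finally show ?thesis using assms by simp
qed

lemma finite_real_spectrum:
  assumes "hermitian_mat A" shows "finite (real_spectrum A)"
proof -
  have "\<exists>v. v \<in> eigenspace A l \<and> v \<noteq> 0" if "l \<in> real_spectrum A" for l
    using that subspace_0[OF eigenspace_subspace[of A l]] by (auto simp: real_spectrum_def)
  then obtain e where e: "\<And>l. l \<in> real_spectrum A \<Longrightarrow> e l \<in> eigenspace A l \<and> e l \<noteq> 0"
    by metis
  have orth: "e l \<bullet> e m = 0" if "l \<in> real_spectrum A" "m \<in> real_spectrum A" "l \<noteq> m" for l m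
    using eigenspaces_orthogonal[OF assms, of "e l" l "e m" m] e that
    by (simp flip: Re_cinner_vec)
  have inj: "inj_on e (real_spectrum A)"
    by (rule inj_onI) (metis e orth inner_eq_zero_iff)
  have "independent (e ` real_spectrum A)"
    using e orth
    by (intro pairwise_orthogonal_independent) (force simp: pairwise_def orthogonal_def)+
  then show ?thesis
    using inj finite_imageD independent_bound by blast
qed

lemma orth_proj_eigenspace_linear:
  "Vector_Spaces.linear (*s) (*s) (orth_proj cinner_vec (eigenspace A l))"
proof -
  let ?P = "orth_proj cinner_vec (eigenspace A l)"
  have P: "?P v \<in> eigenspace A l" "\<And>z. z \<in> eigenspace A l \<Longrightarrow> cinner_vec z (?P v) = cinner_vec z v"
    for v using orth_proj_eigenspace[of A l v "?P v"] by (auto simp: cinner_vec_simps)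
  have "?P (v + w) = ?P v + ?P w" for v w
    unfolding orth_proj_eigenspace using P
    by (auto simp: cinner_vec_simps subspace_add[OF eigenspace_subspace])
  moreover have "?P (c *s v) = c *s ?P v" for c v
    unfolding orth_proj_eigenspace using P
    by (auto simp: cinner_vec_simps eigenspace_scale)
  ultimately show ?thesis by (unfold_locales) auto
qed

lemma mat_fun_eigenvector:
  assumes A: "hermitian_mat A" and v: "v \<in> eigenspace A l"
  shows "mat_fun f A *v v = complex_of_real (f l) *s v"
proof (cases "v = 0")
  case False
  let ?P = "\<lambda>m. orth_proj cinner_vec (eigenspace A m)"
  have l: "l \<in> real_spectrum A" using v False by (auto simp: real_spectrum_def)
  have P: "?P m v = (if m = l then v else 0)" for m
    unfolding orth_proj_eigenspace
    using v eigenspaces_orthogonal[OF A _ v, of _ m] subspace_0[OF eigenspace_subspace[of A m]]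
    by (auto simp: cinner_vec_def)
  have mv: "(\<Sum>m\<in>F. B m) *v v = (\<Sum>m\<in>F. B m *v v)" for F :: "real set" and B :: "real \<Rightarrow> complex^'a^'a"
    by (induction F rule: infinite_finite_induct) (simp_all add: matrix_vector_mult_add_rdistrib)
  have sc: "(a *\<^sub>R B) *v v = a *\<^sub>R (B *v v)" for a and B :: "complex^'a^'a"
    by (simp add: matrix_vector_mult_def vec_eq_iff scaleR_sum_right)
  have "mat_fun f A *v v = (\<Sum>m\<in>real_spectrum A. f m *\<^sub>R (matrix (?P m) *v v))"
    unfolding mat_fun_def mv sc ..
  also have "\<dots> = (\<Sum>m\<in>real_spectrum A. f m *\<^sub>R ?P m v)"
    by (simp add: matrix_works[OF orth_proj_eigenspace_linear])
  also have "\<dots> = (\<Sum>m\<in>real_spectrum A. if m = l then f l *\<^sub>R v else 0)"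
    by (intro sum.cong) (auto simp: P)
  also have "\<dots> = f l *\<^sub>R v"
    using l finite_real_spectrum[OF A] by simp
  finally show ?thesis by (simp add: scaleR_eq_smult)
qed simp

end

theory Submission
  imports Defs "HOL-Real_Asymp.Real_Asymp"
begin

text \<open>
  On \<open>M\<close>, \<open>\<Delta> = \<Delta>\<^sub>\<sigma>\<^sub>,\<^sub>\<rho>\<close> is a positive operator, \<open>U X = X \<rho>\<^sub>N\<^sup>-\<^sup>1\<^sup>/\<^sup>2 \<rho>\<^sup>1\<^sup>/\<^sup>2\<close> is an isometry of \<open>N\<close> into \<open>M\<close>, and \<open>U\<^sup>* \<Delta> U\<close> is the
  relative modular operator \<open>\<Delta>\<^sub>N\<close> of the restricted states. Let \<open>\<xi> = \<rho>\<^sup>1\<^sup>/\<^sup>2 = U \<rho>\<^sub>N\<^sup>1\<^sup>/\<^sup>2\<close> and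
  \<open>w\<^sub>t = U (t + \<Delta>\<^sub>N)\<^sup>-\<^sup>1 \<rho>\<^sub>N\<^sup>1\<^sup>/\<^sup>2 - (t + \<Delta>)\<^sup>-\<^sup>1 \<xi>\<close>. Writing \<open>- ln\<close> as an integral of resolvents turns the entropy
  difference \<open>D\<close> into \<open>\<integral>\<^sub>0\<^sup>\<infinity> \<langle>w\<^sub>t, (t + \<Delta>) w\<^sub>t\<rangle> dt \<ge> \<integral>\<^sub>0\<^sup>T t |w\<^sub>t|\<^sup>2 dt\<close>, whereas the square root is an integral of
  resolvents with weight \<open>\<surd>t\<close>: up to a tail of norm at most \<open>4 |\<Delta>| / \<surd>T\<close>,
  \<open>\<pi> (U \<Delta>\<^sub>N\<^sup>1\<^sup>/\<^sup>2 \<rho>\<^sub>N\<^sup>1\<^sup>/\<^sup>2 - \<Delta>\<^sup>1\<^sup>/\<^sup>2 \<xi>)\<close> is \<open>- \<integral>\<^sub>0\<^sup>T \<surd>t w\<^sub>t dt\<close>, whose norm is at most \<open>\<surd>(T D)\<close> by Cauchy-Schwarz.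
  Optimising over \<open>T\<close> bounds the vector \<open>V = \<sigma>\<^sub>N\<^sup>1\<^sup>/\<^sup>2 \<rho>\<^sub>N\<^sup>-\<^sup>1\<^sup>/\<^sup>2 \<rho>\<^sup>1\<^sup>/\<^sup>2 - \<sigma>\<^sup>1\<^sup>/\<^sup>2\<close>. Finally, the recovered state is \<open>Y\<^sup>* Y\<close> with
  \<open>Y = \<rho>\<^sub>N\<^sup>1\<^sup>/\<^sup>2 \<sigma>\<^sub>N\<^sup>-\<^sup>1\<^sup>/\<^sup>2 \<sigma>\<^sup>1\<^sup>/\<^sup>2\<close> of norm 1, and \<open>\<rho>\<^sup>1\<^sup>/\<^sup>2 - Y = \<rho>\<^sub>N\<^sup>1\<^sup>/\<^sup>2 \<sigma>\<^sub>N\<^sup>-\<^sup>1\<^sup>/\<^sup>2 V\<close>.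
\<close>

subsection \<open>Spectral theorem\<close>

text \<open>The quadratic form \<open>x \<bullet> f x\<close> attains its maximum on the compact
  unit sphere of \<open>S\<close>, and the first variation at a maximiser vanishes.\<close>

lemma has_maximum_eigenvector:
  fixes f :: "'a::euclidean_space \<Rightarrow> 'a"
  assumes f: "linear f" and sym: "\<And>x y. x \<bullet> f y = f x \<bullet> y"
    and S: "subspace S" and inv: "\<And>x. x \<in> S \<Longrightarrow> f x \<in> S" and ne: "S \<noteq> {0}"
  obtains v l where "v \<in> S" "v \<noteq> 0" "f v = l *\<^sub>R v"
proof -
  have cf: "continuous_on UNIV f"
    using f linear_continuous_on linear_conv_bounded_linear by blast
  let ?K = "S \<inter> sphere 0 1"
  have "compact ?K"
    using closed_subspace[OF S] by (simp add: closed_Int_compact)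
  moreover obtain z where z: "z \<in> S" "z \<noteq> 0"
    using ne subspace_0[OF S] by auto
  then have "(1 / norm z) *\<^sub>R z \<in> ?K"
    using S by (simp add: subspace_scale)
  then have "?K \<noteq> {}" by blast
  moreover have "continuous_on ?K (\<lambda>x. x \<bullet> f x)"
    by (intro continuous_intros continuous_on_subset[OF cf]) auto
  ultimately obtain v where v: "v \<in> ?K" "\<And>x. x \<in> ?K \<Longrightarrow> x \<bullet> f x \<le> v \<bullet> f v"
    using continuous_attains_sup by (metis (no_types, lifting))
  define l where "l = v \<bullet> f v"
  have v1: "v \<in> S" "v \<bullet> v = 1"
    using v(1) by (auto simp: dot_square_norm)
  have q: "x \<bullet> f x \<le> l * (x \<bullet> x)" if "x \<in> S" for x
  proof (cases "x = 0")
    case False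
    have "(1 / norm x) *\<^sub>R x \<in> ?K"
      using S that False by (simp add: subspace_scale)
    from v(2)[OF this] have "(x \<bullet> f x) / (norm x)\<^sup>2 \<le> l"
      using False by (simp add: l_def linear_cmul[OF f] power2_eq_square field_simps)
    then show ?thesis
      using False by (simp add: field_simps dot_square_norm)
  qed (simp add: linear_0[OF f])
  define h where "h = f v - l *\<^sub>R v"
  have h: "h \<in> S"
    using v1 inv S by (simp add: h_def subspace_diff subspace_scale)
  \<comment> \<open>\<open>s \<mapsto> l |v + s h|\<^sup>2 - \<langle>v + s h, f (v + s h)\<rangle>\<close> is nonnegative with value 0 at \<open>s = 0\<close>,
    so its derivative \<open>- 2 |h|\<^sup>2\<close> there vanishes.\<close>
  have eq: "l * ((v + s *\<^sub>R h) \<bullet> (v + s *\<^sub>R h)) - (v + s *\<^sub>R h) \<bullet> f (v + s *\<^sub>R h)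
      = s\<^sup>2 * (l * (h \<bullet> h) - h \<bullet> f h) - 2 * s * (h \<bullet> h)" for s
  proof -
    have 1: "v \<bullet> f h = f v \<bullet> h" using sym by simp
    have 2: "f v = h + l *\<^sub>R v" by (simp add: h_def)
    show ?thesis
      using v1(2) l_def
      by (simp add: linear_add[OF f] linear_cmul[OF f] inner_simps 1 inner_commute[of h "f v"])
        (simp add: 2 inner_simps inner_commute power2_eq_square algebra_simps)
  qed
  have "h \<bullet> h = 0"
  proof (rule ccontr)
    assume "h \<bullet> h \<noteq> 0"
    then have hp: "h \<bullet> h > 0" by simp
    define C where "C = \<bar>l * (h \<bullet> h) - h \<bullet> f h\<bar> + 1"
    define s where "s = (h \<bullet> h) / C"
    have C: "C > 0" by (simp add: C_def)
    have s: "s > 0" using hp C by (simp add: s_def)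
    have "0 \<le> s\<^sup>2 * (l * (h \<bullet> h) - h \<bullet> f h) - 2 * s * (h \<bullet> h)"
      using q[of "v + s *\<^sub>R h"] v1 h S
      by (simp add: subspace_add subspace_scale flip: eq)
    also have "\<dots> \<le> s\<^sup>2 * C - 2 * s * (h \<bullet> h)"
      unfolding C_def by (intro diff_right_mono mult_left_mono) auto
    also have "\<dots> = - s * (h \<bullet> h)"
      using C by (simp add: s_def power2_eq_square field_simps)
    also have "\<dots> < 0" using s hp by simp
    finally show False by simp
  qed
  then have "f v = l *\<^sub>R v" by (simp add: h_def)
  with v1 show ?thesis using that[of v l] by force
qed

text \<open>By symmetry the orthogonal complement of all eigenvectors is invariant; were it nonzero,
  it would contain an eigenvector orthogonal to itself.\<close>

theorem symmetric_eigenvectors_span: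
  fixes f :: "'a::euclidean_space \<Rightarrow> 'a"
  assumes f: "linear f" and sym: "\<And>x y. x \<bullet> f y = f x \<bullet> y"
  shows "span {v. \<exists>l. f v = l *\<^sub>R v} = UNIV"
proof (rule ccontr)
  let ?E = "{v. \<exists>l. f v = l *\<^sub>R v}"
  let ?S = "{x. \<forall>v\<in>?E. orthogonal x v}"
  assume "span ?E \<noteq> UNIV"
  then obtain z where "z \<noteq> 0" "\<And>x. x \<in> span ?E \<Longrightarrow> orthogonal z x"
    using orthogonal_to_subspace_exists_gen[of ?E UNIV] by auto
  then have "z \<in> ?S" "z \<noteq> 0" by (auto intro: span_base)
  then have ne: "?S \<noteq> {0}" by blast
  have S: "subspace ?S"
    by (auto simp: subspace_def orthogonal_def inner_simps)
  have "f x \<in> ?S" if "x \<in> ?S" for x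
    using that by (auto simp: orthogonal_def simp flip: sym)
  then obtain v l where "v \<in> ?S" "v \<noteq> 0" "f v = l *\<^sub>R v"
    using has_maximum_eigenvector[OF f sym S _ ne] by blast
  then show False by (auto simp: orthogonal_def)
qed

subsection \<open>Spectral sums of a compressed operator\<close>

lemma sum_scaleR_inner_orthogonal:
  fixes e :: "'i \<Rightarrow> 'a::real_inner"
  assumes "finite I" "pairwise (\<lambda>i j. e i \<bullet> e j = 0) I"
  shows "(\<Sum>i\<in>I. a i *\<^sub>R e i) \<bullet> (\<Sum>i\<in>I. b i *\<^sub>R e i) = (\<Sum>i\<in>I. a i * b i * (norm (e i))\<^sup>2)"
proof -
  have "(\<Sum>j\<in>I. a i * (b j * (e i \<bullet> e j))) = a i * b i * (norm (e i))\<^sup>2" if "i \<in> I" for i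
  proof -
    have "(\<Sum>j\<in>I. a i * (b j * (e i \<bullet> e j))) = (\<Sum>j\<in>I. if j = i then a i * b i * (norm (e i))\<^sup>2 else 0)"
      using assms(2) that by (intro sum.cong) (auto simp: pairwise_def dot_square_norm)
    then show ?thesis using assms(1) that by simp
  qed
  then show ?thesis
    by (subst inner_sum_left) (simp add: inner_sum_right mult.left_commute)
qed

text \<open>Pythagoras. Coefficients are bounded only where \<open>e i\<close> is nonzero, because
  only nonzero spectral components allow comparing their eigenvalue with an operator norm.\<close>

lemma norm_sum_scaleR_orthogonal_le:
  fixes e :: "'i \<Rightarrow> 'a::real_inner"
  assumes "finite I" "pairwise (\<lambda>i j. e i \<bullet> e j = 0) I"
    and "\<And>i. i \<in> I \<Longrightarrow> e i \<noteq> 0 \<Longrightarrow> \<bar>a i\<bar> \<le> C" and "C \<ge> 0"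
  shows "norm (\<Sum>i\<in>I. a i *\<^sub>R e i) \<le> C * norm (\<Sum>i\<in>I. e i)"
proof -
  have "(norm (\<Sum>i\<in>I. a i *\<^sub>R e i))\<^sup>2 = (\<Sum>i\<in>I. a i * a i * (norm (e i))\<^sup>2)"
    using sum_scaleR_inner_orthogonal[OF assms(1,2)] by (simp add: dot_square_norm[symmetric])
  also have "\<dots> \<le> (\<Sum>i\<in>I. C\<^sup>2 * (norm (e i))\<^sup>2)"
  proof (rule sum_mono)
    fix i assume "i \<in> I"
    show "a i * a i * (norm (e i))\<^sup>2 \<le> C\<^sup>2 * (norm (e i))\<^sup>2"
    proof (cases "e i = 0")
      case False
      then have "(a i)\<^sup>2 \<le> C\<^sup>2"
        using assms(3)[OF \<open>i \<in> I\<close>] assms(4) abs_le_square_iff[of "a i" C] by simp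
      then show ?thesis by (intro mult_right_mono) (auto simp: power2_eq_square)
    qed simp
  qed
  also have "\<dots> = (C * norm (\<Sum>i\<in>I. e i))\<^sup>2"
    using sum_scaleR_inner_orthogonal[OF assms(1,2), of "\<lambda>_. 1" "\<lambda>_. 1"]
    by (simp add: power_mult_distrib sum_distrib_left dot_square_norm)
  finally show ?thesis
    using assms(4) by (auto intro: power2_le_imp_le)
qed

section \<open>Scalar estimates for the integral of the square root\<close>

text \<open>The left side is the integral of \<open>x / (u^2 + x)\<close> over \<open>u > a\<close>;
  reflecting the arctangent and \<open>arctan y \<le> y\<close> bound it.\<close>

lemma sqrt_arctan_tail:
  fixes x a :: real
  assumes "x > 0" "a > 0"
  shows "\<bar>pi / 2 * sqrt x - sqrt x * arctan (a / sqrt x)\<bar> \<le> x / a"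
proof -
  have 1: "pi / 2 - arctan (a / sqrt x) = arctan (sqrt x / a)"
    using arctan_inverse[of "a / sqrt x"] assms by (simp add: sgn_if)
  have 2: "0 \<le> arctan (sqrt x / a)" "arctan (sqrt x / a) \<le> sqrt x / a"
    using assms by (auto intro: arctan_le_self)
  have "\<bar>pi / 2 * sqrt x - sqrt x * arctan (a / sqrt x)\<bar> = sqrt x * arctan (sqrt x / a)"
    using 2(1) assms by (simp add: 1[symmetric] algebra_simps)
  also have "\<dots> \<le> sqrt x * (sqrt x / a)"
    using 2(2) assms by (intro mult_left_mono) auto
  finally show ?thesis using assms by simp
qed

lemma sqrt_arctan_deriv:
  fixes x :: real
  assumes "x > 0"
  shows "((\<lambda>u. sqrt x * arctan (u / sqrt x)) has_real_derivative x / (u\<^sup>2 + x)) (at u)"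
proof -
  have "x + u\<^sup>2 > 0" using assms by (simp add: add_pos_nonneg)
  then show ?thesis
    using assms
    by (auto intro!: derivative_eq_intros simp: power_divide field_simps)
qed

text \<open>The bound in the last assumption is smallest at
  \<open>a = 2 * sqrt (L / \<epsilon>)\<close>, where both of its terms equal
  \<open>sqrt (L * \<epsilon>)\<close>.\<close>

lemma fourth_power_bound:
  fixes v L D :: real
  assumes v: "v \<ge> 0" and L: "L > 0" and D: "D \<ge> 0"
    and *: "\<And>a \<epsilon>. a > 0 \<Longrightarrow> \<epsilon> > 0 \<Longrightarrow> D \<le> \<epsilon>\<^sup>2 \<Longrightarrow> pi / 2 * v \<le> a * \<epsilon> / 2 + 2 * L / a"
  shows "(pi / 4) ^ 4 * v ^ 4 \<le> L\<^sup>2 * D"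
proof -
  have "(pi / 4) ^ 4 * v ^ 4 \<le> L\<^sup>2 * D + \<delta>" if "\<delta> > 0" for \<delta>
  proof -
    \<comment> \<open>The extra summand keeps \<open>\<epsilon>\<close> positive even for
      \<open>D = 0\<close> and becomes exactly \<open>\<delta>\<close> after multiplication by
      \<open>L^2\<close>.\<close>
    define \<epsilon> where "\<epsilon> = sqrt (D + \<delta> / L\<^sup>2)"
    define r where "r = sqrt (L * \<epsilon>)"
    have e: "\<epsilon> > 0" "\<epsilon>\<^sup>2 = D + \<delta> / L\<^sup>2"
      using that L D by (auto simp: \<epsilon>_def add_nonneg_pos)
    have r: "r > 0" "r\<^sup>2 = L * \<epsilon>" using e L by (auto simp: r_def)
    have "2 * L / (2 * r / \<epsilon>) = r"
      using r e by (simp add: field_simps power2_eq_square)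
    moreover have "pi / 2 * v \<le> (2 * r / \<epsilon>) * \<epsilon> / 2 + 2 * L / (2 * r / \<epsilon>)"
      using e r L that by (intro *) auto
    ultimately have "pi / 4 * v \<le> r" using e by simp
    then have "(pi / 4 * v) ^ 4 \<le> r ^ 4" using v by (intro power_mono) auto
    also have "r ^ 4 = (L * \<epsilon>)\<^sup>2" unfolding r(2)[symmetric] by simp
    also have "\<dots> = L\<^sup>2 * D + \<delta>" using e L by (simp add: power_mult_distrib field_simps)
    finally show ?thesis by (simp only: power_mult_distrib)
  qed
  then show ?thesis by (rule field_le_epsilon)
qed

text \<open>The substitution \<open>t = u\<^sup>2\<close> makes the integrands of
  \<open>ln x = \<integral> (1/(1+t) - 1/(t+x)) dt\<close> and \<open>\<pi> \<surd>x = \<integral> \<surd>t (1/t - 1/(t+x)) dt\<close> smooth at 0;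
  the partial integrals are replaced by their primitives \<open>ln (u\<^sup>2 + x)\<close> and
  \<open>2 \<surd>x arctan (u / \<surd>x)\<close>.\<close>

lemma spectral_sum_difference_bound:
  fixes e :: "'i \<Rightarrow> 'a::real_inner" and h :: "'j \<Rightarrow> 'a"
  assumes A: "linear A" and sym: "\<And>v w. v \<bullet> A w = A v \<bullet> w" and psd: "\<And>v. 0 \<le> v \<bullet> A v"
    and I: "finite I" "pairwise (\<lambda>i j. e i \<bullet> e j = 0) I"
    and J: "finite J" "pairwise (\<lambda>i j. h i \<bullet> h j = 0) J"
    and pos: "\<And>i. i \<in> I \<Longrightarrow> x i > 0" "\<And>j. j \<in> J \<Longrightarrow> y j > 0"
    and eig: "\<And>i. i \<in> I \<Longrightarrow> A (e i) = x i *\<^sub>R e i"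
    and comp: "\<And>i j. i \<in> J \<Longrightarrow> j \<in> J \<Longrightarrow> h i \<bullet> A (h j) = y j * (h i \<bullet> h j)"
    and xi: "(\<Sum>i\<in>I. e i) = \<xi>" "(\<Sum>j\<in>J. h j) = \<xi>" "norm \<xi> = 1"
    and bound: "\<And>i. i \<in> I \<Longrightarrow> e i \<noteq> 0 \<Longrightarrow> x i \<le> L" "\<And>j. j \<in> J \<Longrightarrow> h j \<noteq> 0 \<Longrightarrow> y j \<le> L"
    and L: "L > 0"
  defines "D \<equiv> (\<Sum>j\<in>J. ln (y j) *\<^sub>R h j) \<bullet> \<xi> - (\<Sum>i\<in>I. ln (x i) *\<^sub>R e i) \<bullet> \<xi>"
  shows "(pi / 4) ^ 4 * norm ((\<Sum>j\<in>J. sqrt (y j) *\<^sub>R h j) - (\<Sum>i\<in>I. sqrt (x i) *\<^sub>R e i)) ^ 4 \<le> L\<^sup>2 * D"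
proof -
  define \<phi> where "\<phi> f = (\<Sum>i\<in>I. f (x i) *\<^sub>R e i)" for f :: "real \<Rightarrow> real"
  define \<psi> where "\<psi> f = (\<Sum>j\<in>J. f (y j) *\<^sub>R h j)" for f :: "real \<Rightarrow> real"
  define c where "c i = (norm (e i))\<^sup>2" for i
  define d where "d j = (norm (h j))\<^sup>2" for j
  have phi_xi: "\<phi> f \<bullet> \<xi> = (\<Sum>i\<in>I. f (x i) * c i)" for f
    using sum_scaleR_inner_orthogonal[OF I, of "\<lambda>i. f (x i)" "\<lambda>_. 1"] xi by (simp add: \<phi>_def c_def)
  have psi_xi: "\<psi> f \<bullet> \<xi> = (\<Sum>j\<in>J. f (y j) * d j)" for f
    using sum_scaleR_inner_orthogonal[OF J, of "\<lambda>j. f (y j)" "\<lambda>_. 1"] xi by (simp add: \<psi>_def d_def)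
  have one: "\<phi> (\<lambda>_. 1) = \<xi>" "\<psi> (\<lambda>_. 1) = \<xi>" by (simp_all add: \<phi>_def \<psi>_def xi)
  have mass: "(\<Sum>i\<in>I. c i) = 1" "(\<Sum>j\<in>J. d j) = 1"
    using phi_xi[of "\<lambda>_. 1"] psi_xi[of "\<lambda>_. 1"] one xi by (simp_all add: dot_square_norm)
  have lin: "\<phi> (\<lambda>z. a * f z + b * g z) = a *\<^sub>R \<phi> f + b *\<^sub>R \<phi> g"
      "\<psi> (\<lambda>z. a * f z + b * g z) = a *\<^sub>R \<psi> f + b *\<^sub>R \<psi> g" for a b f g
    by (simp_all add: \<phi>_def \<psi>_def scaleR_sum_right sum.distrib scaleR_add_left)
  have A_phi: "A (\<phi> f) = \<phi> (\<lambda>z. z * f z)" for f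
    by (simp add: \<phi>_def linear_sum[OF A] linear_cmul[OF A] eig mult.commute)
  \<comment> \<open>\<open>comp\<close> determines \<open>A (\<psi> g)\<close> only up to vectors
    orthogonal to all \<open>h i\<close>, hence the pairing with \<open>\<psi> f\<close>.\<close>
  have A_psi: "\<psi> f \<bullet> A (\<psi> g) = \<psi> f \<bullet> \<psi> (\<lambda>z. z * g z)" for f g
    unfolding \<psi>_def linear_sum[OF A] linear_cmul[OF A]
    by (auto simp: inner_sum_left inner_sum_right comp sum_distrib_left mult_ac intro!: sum.cong)
  \<comment> \<open>With \<open>t = u^2\<close>, \<open>r u\<close> is the resolvent function,
    \<open>w u\<close> the difference of the two resolvent vectors, and \<open>G u\<close> the
    integrand in \<open>t\<close> whose integral is \<open>D\<close>.\<close>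
  define r where "r u = (\<lambda>z::real. 1 / (u\<^sup>2 + z))" for u :: real
  define w where "w u = \<psi> (r u) - \<phi> (r u)" for u
  define G where "G u = \<phi> (r u) \<bullet> \<xi> - \<psi> (r u) \<bullet> \<xi>" for u
  have congJ: "\<psi> f = \<psi> g" if "\<And>z. z > 0 \<Longrightarrow> f z = g z" for f g
    using that pos by (auto simp: \<psi>_def intro!: sum.cong)
  have congI: "\<phi> f = \<phi> g" if "\<And>z. z > 0 \<Longrightarrow> f z = g z" for f g
    using that pos by (auto simp: \<phi>_def intro!: sum.cong)
  have den: "u\<^sup>2 + z > 0" if "z > 0" for u z :: real
    using that by (simp add: add_nonneg_pos)
  have res: "z * r u z = 1 * 1 + (- (u\<^sup>2)) * r u z" if "z > 0" for u z
    using den[OF that, of u] by (simp add: r_def field_simps)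
  have res_psi: "\<psi> (\<lambda>z. z * r u z) = \<xi> - u\<^sup>2 *\<^sub>R \<psi> (r u)" for u
    using congJ[OF res] lin(2)[of 1 "\<lambda>_. 1" "- (u\<^sup>2)" "r u"] one by simp
  have res_phi: "\<phi> (\<lambda>z. z * r u z) = \<xi> - u\<^sup>2 *\<^sub>R \<phi> (r u)" for u
    using congI[OF res] lin(1)[of 1 "\<lambda>_. 1" "- (u\<^sup>2)" "r u"] one by simp
  \<comment> \<open>Symmetry moves \<open>A\<close> onto \<open>\<phi> (r u)\<close> in the mixed
    terms of \<open>w u \<bullet> A (w u)\<close>. The resolvent identities then leave
    \<open>G u\<close> minus the left side, which is nonnegative by \<open>psd\<close>.\<close>
  have G_ge: "u\<^sup>2 * (norm (w u))\<^sup>2 \<le> G u" for u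
  proof -
    let ?p = "\<phi> (r u)" and ?q = "\<psi> (r u)"
    have 1: "?q \<bullet> A ?q = ?q \<bullet> \<xi> - u\<^sup>2 * (?q \<bullet> ?q)"
      by (simp add: A_psi res_psi inner_simps)
    have 2: "v \<bullet> A ?p = v \<bullet> \<xi> - u\<^sup>2 * (v \<bullet> ?p)" for v
      by (simp add: A_phi res_phi inner_simps)
    have 3: "?p \<bullet> A ?q = ?q \<bullet> A ?p" by (metis sym inner_commute)
    have "w u \<bullet> A (w u) = ?q \<bullet> A ?q - 2 * (?q \<bullet> A ?p) + ?p \<bullet> A ?p"
      unfolding w_def linear_diff[OF A] using 3 by (simp add: inner_simps)
    also have "\<dots> = G u - u\<^sup>2 * (norm (w u))\<^sup>2"
      unfolding 1 2 G_def w_def dot_square_norm[symmetric]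
      by (simp add: inner_simps algebra_simps inner_commute[of ?p ?q])
    finally show ?thesis using psd[of "w u"] by simp
  qed
  \<comment> \<open>The primitive of \<open>2 * u * G u\<close> vanishing at 0; it increases to
    \<open>D\<close>.\<close>
  define H where "H u = (\<Sum>i\<in>I. (ln (u\<^sup>2 + x i) - ln (x i)) * c i)
      - (\<Sum>j\<in>J. (ln (u\<^sup>2 + y j) - ln (y j)) * d j)" for u :: real
  have D_eq: "D = (\<Sum>j\<in>J. ln (y j) * d j) - (\<Sum>i\<in>I. ln (x i) * c i)"
    using phi_xi[of ln] psi_xi[of ln] by (simp add: D_def \<phi>_def \<psi>_def)
  have H': "(H has_real_derivative 2 * u * G u) (at u)" for u
  proof -
    have "((\<lambda>u. (ln (u\<^sup>2 + z) - ln z) * k) has_real_derivative 2 * u * (r u z * k)) (at u)"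
      if "z > 0" for z k
      using den[OF that, of u] that unfolding r_def
      by (auto intro!: derivative_eq_intros)
    then have "(H has_real_derivative (\<Sum>i\<in>I. 2 * u * (r u (x i) * c i))
        - (\<Sum>j\<in>J. 2 * u * (r u (y j) * d j))) (at u)"
      unfolding H_def using pos by (intro DERIV_diff DERIV_sum) auto
    then show ?thesis
      by (simp add: G_def phi_xi psi_xi sum_distrib_left[symmetric] right_diff_distrib)
  qed
  have H_mono: "H u \<le> H v" if "0 \<le> u" "u \<le> v" for u v
  proof (rule DERIV_nonneg_imp_nondecreasing[OF that(2)])
    fix z assume "u \<le> z"
    then have "0 \<le> 2 * z * G z"
      using that(1) order_trans[OF _ G_ge[of z]] by simp
    then show "\<exists>k. (H has_real_derivative k) (at z) \<and> 0 \<le> k" using H' by blast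
  qed
  have H0: "H 0 = 0" by (simp add: H_def)
  have H_lim: "(H \<longlongrightarrow> D) at_top"
  proof -
    have t: "((\<lambda>u. (ln (u\<^sup>2 + z) - ln (u\<^sup>2)) * k) \<longlongrightarrow> 0) at_top" if "z > 0" for z k :: real
      using that by real_asymp
    \<comment> \<open>Both weight families have total mass 1, so subtracting \<open>ln (u^2)\<close>
      from every logarithm leaves the difference unchanged.\<close>
    have "((\<lambda>u. D + ((\<Sum>i\<in>I. (ln (u\<^sup>2 + x i) - ln (u\<^sup>2)) * c i)
        - (\<Sum>j\<in>J. (ln (u\<^sup>2 + y j) - ln (u\<^sup>2)) * d j))) \<longlongrightarrow> D + ((\<Sum>i\<in>I. 0) - (\<Sum>j\<in>J. 0))) at_top"
      by (intro tendsto_intros t pos)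
    moreover have "D + ((\<Sum>i\<in>I. (ln (u\<^sup>2 + x i) - ln (u\<^sup>2)) * c i)
        - (\<Sum>j\<in>J. (ln (u\<^sup>2 + y j) - ln (u\<^sup>2)) * d j)) = H u" for u
      unfolding D_eq H_def left_diff_distrib sum_subtractf sum_distrib_left[symmetric] mass by simp
    ultimately show ?thesis by simp
  qed
  have H_le: "H u \<le> D" if "0 \<le> u" for u
    by (rule tendsto_lowerbound[OF H_lim])
      (use H_mono that in \<open>auto intro: eventually_mono[OF eventually_ge_at_top[of u]]\<close>)
  have D0: "D \<ge> 0" using H_le[of 0] H0 by simp
  define g where "g u = (\<lambda>z::real. sqrt z * arctan (u / sqrt z))" for u
  define F where "F u = \<psi> (g u) - \<phi> (g u)" for u
  \<comment> \<open>Instead of Cauchy-Schwarz for integrals, Young's inequality with weight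
    \<open>\<kappa>\<close> is applied to the integrand: \<open>G_ge\<close> makes the difference
    \<open>K\<close> of the two sides nondecreasing from \<open>K 0 = 0\<close>.\<close>
  have F_inner: "z \<bullet> F a \<le> (\<kappa> * a\<^sup>2 + H a / \<kappa>) / 4" if "a \<ge> 0" "\<kappa> > 0" "norm z = 1" for a \<kappa> z
  proof -
    define K where "K u = (\<kappa> * u\<^sup>2 + H u / \<kappa>) / 4 - z \<bullet> F u" for u
    have "z \<bullet> F u = (\<Sum>j\<in>J. g u (y j) * (z \<bullet> h j)) - (\<Sum>i\<in>I. g u (x i) * (z \<bullet> e i))" for u
      by (simp add: F_def \<phi>_def \<psi>_def inner_simps inner_sum_right)
    moreover have "((\<lambda>u. g u s * k) has_real_derivative (s * r u s) * k) (at u)" if "s > 0" for s k u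
      using DERIV_cmult_right[OF sqrt_arctan_deriv[OF that]] unfolding g_def r_def by simp
    ultimately have "((\<lambda>u. z \<bullet> F u) has_real_derivative
        (\<Sum>j\<in>J. (y j * r u (y j)) * (z \<bullet> h j)) - (\<Sum>i\<in>I. (x i * r u (x i)) * (z \<bullet> e i))) (at u)" for u
      using pos by (auto intro!: DERIV_diff DERIV_sum)
    moreover have "(\<Sum>j\<in>J. (y j * r u (y j)) * (z \<bullet> h j)) - (\<Sum>i\<in>I. (x i * r u (x i)) * (z \<bullet> e i))
        = - (u\<^sup>2 * (z \<bullet> w u))" for u
    proof -
      have "(\<Sum>j\<in>J. (y j * r u (y j)) * (z \<bullet> h j)) - (\<Sum>i\<in>I. (x i * r u (x i)) * (z \<bullet> e i))
        = z \<bullet> (\<psi> (\<lambda>s. s * r u s) - \<phi> (\<lambda>s. s * r u s))"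
        by (simp add: \<phi>_def \<psi>_def inner_simps inner_sum_right)
      then show ?thesis unfolding res_psi res_phi w_def by (simp add: inner_simps algebra_simps)
    qed
    ultimately have F': "((\<lambda>u. z \<bullet> F u) has_real_derivative - (u\<^sup>2 * (z \<bullet> w u))) (at u)" for u
      by simp
    have K': "(K has_real_derivative (\<kappa> * (2 * u) + 2 * u * G u / \<kappa>) / 4 + u\<^sup>2 * (z \<bullet> w u)) (at u)" for u
      unfolding K_def using that by (auto intro!: derivative_eq_intros H' F')
    have "K 0 \<le> K a"
    proof (rule DERIV_nonneg_imp_nondecreasing[OF that(1)])
      fix u :: real assume u: "0 \<le> u"
      have "\<bar>z \<bullet> w u\<bar> \<le> norm (w u)"
        using Cauchy_Schwarz_ineq2[of z "w u"] that(3) by simp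
      then have "u\<^sup>2 * \<bar>z \<bullet> w u\<bar> \<le> u\<^sup>2 * norm (w u)" by (rule mult_left_mono) simp
      moreover have "u\<^sup>2 * \<bar>z \<bullet> w u\<bar> = \<bar>u\<^sup>2 * (z \<bullet> w u)\<bar>" by (simp add: abs_mult)
      moreover have "u\<^sup>2 * norm (w u) \<le> (\<kappa> * (2 * u) + 2 * u * G u / \<kappa>) / 4"
      proof -
        have "0 \<le> u * (\<kappa> - u * norm (w u))\<^sup>2 / \<kappa>" using u that by simp
        also have "\<dots> = \<kappa> * u - 2 * (u\<^sup>2 * norm (w u)) + u * (u\<^sup>2 * (norm (w u))\<^sup>2) / \<kappa>"
          using that by (simp add: power2_eq_square field_simps)
        also have "\<dots> \<le> \<kappa> * u - 2 * (u\<^sup>2 * norm (w u)) + u * G u / \<kappa>"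
          using u that G_ge by (intro add_left_mono divide_right_mono mult_left_mono) auto
        finally have "2 * (u\<^sup>2 * norm (w u)) \<le> \<kappa> * u + u * G u / \<kappa>" by simp
        moreover have "(\<kappa> * (2 * u) + 2 * u * G u / \<kappa>) / 4 = (\<kappa> * u + u * G u / \<kappa>) / 2"
          by (simp add: add_divide_distrib)
        ultimately show ?thesis by simp
      qed
      ultimately have "0 \<le> (\<kappa> * (2 * u) + 2 * u * G u / \<kappa>) / 4 + u\<^sup>2 * (z \<bullet> w u)" by linarith
      then show "\<exists>k. (K has_real_derivative k) (at u) \<and> 0 \<le> k" using K' by blast
    qed
    moreover have "K 0 = 0" by (simp add: K_def H0 F_def \<phi>_def \<psi>_def g_def)
    ultimately show ?thesis by (simp add: K_def)
  qed
  \<comment> \<open>The weight \<open>\<kappa> = \<epsilon> / a\<close> balances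
    \<open>F_inner\<close>: each of its two terms contributes at most
    \<open>a * \<epsilon> / 4\<close>.\<close>
  have F_norm: "norm (F a) \<le> a * \<epsilon> / 2" if "a > 0" "\<epsilon> > 0" "D \<le> \<epsilon>\<^sup>2" for a \<epsilon>
  proof (cases "F a = 0")
    case False
    have "sgn (F a) \<bullet> F a \<le> (\<epsilon> / a * a\<^sup>2 + H a / (\<epsilon> / a)) / 4"
      using F_inner[of a "\<epsilon> / a" "sgn (F a)"] that False by (simp add: norm_sgn)
    also have "\<dots> \<le> (\<epsilon> / a * a\<^sup>2 + \<epsilon>\<^sup>2 / (\<epsilon> / a)) / 4"
      using H_le[of a] that by (intro divide_right_mono add_left_mono) auto
    also have "\<dots> = a * \<epsilon> / 2" using that by (simp add: power2_eq_square)
    finally have "sgn (F a) \<bullet> F a \<le> a * \<epsilon> / 2" .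
    moreover have "sgn (F a) \<bullet> F a = norm (F a)"
      using False by (simp add: sgn_div_norm dot_square_norm power2_eq_square)
    ultimately show ?thesis by simp
  qed (use that in auto)
  let ?V = "\<psi> sqrt - \<phi> sqrt"
  have "pi / 2 * norm ?V \<le> a * \<epsilon> / 2 + 2 * L / a" if a: "a > 0" and "\<epsilon> > 0" "D \<le> \<epsilon>\<^sup>2" for a \<epsilon>
  proof -
    \<comment> \<open>\<open>k\<close> is the tail beyond \<open>a\<close>; its two spectral sums
      account for \<open>2 * L / a\<close>.\<close>
    define k where "k = (\<lambda>z. pi / 2 * sqrt z + (- 1) * g a z)"
    have k: "\<bar>k z\<bar> \<le> L / a" if "0 < z" "z \<le> L" for z
      using sqrt_arctan_tail[OF that(1) a] that a divide_right_mono[of z L a] by (simp add: k_def g_def)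
    have nk: "norm (\<phi> k) \<le> L / a" "norm (\<psi> k) \<le> L / a"
      using norm_sum_scaleR_orthogonal_le[OF I, of "\<lambda>i. k (x i)" "L / a"] k pos bound a L xi
        norm_sum_scaleR_orthogonal_le[OF J, of "\<lambda>i. k (y i)" "L / a"]
      by (simp_all add: \<phi>_def \<psi>_def)
    have "(pi / 2) *\<^sub>R ?V = F a + \<psi> k - \<phi> k"
      unfolding k_def lin F_def by (simp add: algebra_simps)
    then have "pi / 2 * norm ?V = norm (F a + \<psi> k - \<phi> k)"
      by (metis abs_of_nonneg norm_scaleR pi_half_ge_zero)
    also have "\<dots> \<le> norm (F a) + norm (\<psi> k) + norm (\<phi> k)"
      by (meson norm_triangle_ineq norm_triangle_ineq4 order_trans add_right_mono)
    finally show ?thesis using F_norm[OF that] nk by simp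
  qed
  then show ?thesis
    using fourth_power_bound[of "norm ?V" L D] L D0 by (simp add: \<phi>_def \<psi>_def)
qed

subsection \<open>Matrices\<close>

lemma adjoint_mat_simps:
  fixes A B :: "complex^'n^'n"
  shows "adjoint_mat (adjoint_mat A) = A"
    and "adjoint_mat (A ** B) = adjoint_mat B ** adjoint_mat A"
    and "adjoint_mat (A + B) = adjoint_mat A + adjoint_mat B"
    and "adjoint_mat (A - B) = adjoint_mat A - adjoint_mat B"
    and "adjoint_mat (c *\<^sub>R A) = c *\<^sub>R adjoint_mat A"
    and "adjoint_mat (mat 1 :: complex^'n^'n) = mat 1"
  by (auto simp: adjoint_mat_def vec_eq_iff matrix_matrix_mult_def mat_def mult.commute)

lemma inner_matrix_mult_left:
  fixes X Y Z :: "complex^'n^'n"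
  shows "(X ** Y) \<bullet> Z = Y \<bullet> (adjoint_mat X ** Z)"
  by (simp add: hs_inner_def adjoint_mat_simps matrix_mul_assoc flip: Re_hs_inner)

lemma inner_matrix_mult_right:
  fixes X Y Z :: "complex^'n^'n"
  shows "(X ** Y) \<bullet> Z = X \<bullet> (Z ** adjoint_mat Y)"
proof -
  have "hs_inner (X ** Y) Z = trace (adjoint_mat Y ** (adjoint_mat X ** Z))"
    by (simp add: hs_inner_def adjoint_mat_simps matrix_mul_assoc)
  also have "\<dots> = hs_inner X (Z ** adjoint_mat Y)"
    by (subst trace_mul_sym) (simp add: hs_inner_def matrix_mul_assoc)
  finally show ?thesis by (simp flip: Re_hs_inner)
qed

lemma inner_adjoint_mat:
  fixes X Y :: "complex^'n^'n"
  shows "adjoint_mat X \<bullet> adjoint_mat Y = X \<bullet> Y"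
proof -
  have "adjoint_mat X \<bullet> adjoint_mat Y = Y \<bullet> X"
    unfolding Re_hs_inner[symmetric] hs_inner_def adjoint_mat_simps by (metis trace_mul_sym)
  then show ?thesis by (simp add: inner_commute)
qed

lemma norm_adjoint_mat: "norm (adjoint_mat X) = norm (X :: complex^'n^'n)"
  by (simp add: norm_eq_sqrt_inner inner_adjoint_mat)

lemma hermitian_adjoint: "hermitian_mat A \<Longrightarrow> adjoint_mat A = A"
  by (simp add: hermitian_mat_def)

lemma Re_trace_mult: "hermitian_mat A \<Longrightarrow> Re (trace (A ** B)) = A \<bullet> B"
  by (simp add: hermitian_mat_def hs_inner_def flip: Re_hs_inner)

lemma bounded_bilinear_matrix_mult:
  "bounded_bilinear ((**) :: complex^'n^'n \<Rightarrow> complex^'n^'n \<Rightarrow> complex^'n^'n)"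
  unfolding bilinear_conv_bounded_bilinear[symmetric] bilinear_def
proof (intro allI conjI linearI)
  show "(A + B) ** C = A ** C + B ** C" for A B C :: "complex^'n^'n"
    by (simp add: matrix_matrix_mult_def vec_eq_iff distrib_right sum.distrib)
qed (simp_all add: matrix_add_ldistrib matrix_scalar_ac scalar_matrix_assoc)

lemmas matrix_mult_simps =
  bounded_bilinear.sum_left[OF bounded_bilinear_matrix_mult]
  bounded_bilinear.sum_right[OF bounded_bilinear_matrix_mult]
  bounded_bilinear.diff_left[OF bounded_bilinear_matrix_mult]
  bounded_bilinear.diff_right[OF bounded_bilinear_matrix_mult]
  bounded_bilinear.add_left[OF bounded_bilinear_matrix_mult]
  bounded_bilinear.add_right[OF bounded_bilinear_matrix_mult]
  bounded_bilinear.scaleR_left[OF bounded_bilinear_matrix_mult]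
  bounded_bilinear.scaleR_right[OF bounded_bilinear_matrix_mult]

lemma linear_matrix_vector: "linear (\<lambda>v. (A :: complex^'n^'n) *v v)"
  by (rule linearI) (simp_all add: matrix_vector_right_distrib scaleR_eq_smult vector_scalar_commute)

lemma norm_matrix_vector_le: "norm ((A :: complex^'n^'n) *v v) \<le> op_norm A * norm v"
  unfolding op_norm_def
  by (intro onorm) (simp add: linear_matrix_vector flip: linear_conv_bounded_linear)

text \<open>The quadratic form of \<open>A\<close> is real, so that of
  \<open>A - adjoint_mat A\<close> vanishes; polarising with \<open>v + w\<close> and
  \<open>v + \<i> *s w\<close> kills the whole sesquilinear form.\<close>

lemma psd_mat_hermitian:
  fixes A :: "complex^'n^'n"
  assumes "psd_mat A" shows "hermitian_mat A"
proof -
  define B where "B = A - adjoint_mat A"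
  have cnj: "cinner_vec w v = cnj (cinner_vec v w)" for v w :: "complex^'n"
    by (simp add: cinner_vec_def mult.commute)
  have q: "cinner_vec v (B *v v) = 0" for v
  proof -
    have "cinner_vec v (A *v v) \<in> \<real>\<^sub>\<ge>\<^sub>0"
      using assms by (simp add: psd_mat_def)
    then have "cnj (cinner_vec v (A *v v)) = cinner_vec v (A *v v)"
      by (auto elim: nonneg_Reals_cases)
    moreover have "cinner_vec v (adjoint_mat A *v v) = cnj (cinner_vec v (A *v v))"
      by (simp add: cinner_vec_adjoint adjoint_mat_simps cnj[symmetric])
    ultimately show ?thesis
      by (simp add: B_def matrix_vector_mult_diff_rdistrib cinner_vec_simps)
  qed
  have add: "cinner_vec (v + w) z = cinner_vec v z + cinner_vec w z" for v w z :: "complex^'n"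
    by (simp add: cinner_vec_def ring_distribs sum.distrib)
  have "cinner_vec v (B *v w) = 0" for v w
  proof -
    have 1: "cinner_vec v (B *v w) + cinner_vec w (B *v v) = 0"
      using q[of "v + w"] q[of v] q[of w]
      by (simp add: matrix_vector_right_distrib cinner_vec_simps add add.commute)
    have "cinner_vec v (B *v (\<i> *s w)) + cinner_vec (\<i> *s w) (B *v v) = 0"
      using q[of "v + \<i> *s w"] q[of v] q[of "\<i> *s w"]
      by (simp add: matrix_vector_right_distrib cinner_vec_simps(1) add add.commute)
    then have "\<i> * (cinner_vec v (B *v w) - cinner_vec w (B *v v)) = 0"
      by (simp add: cinner_vec_simps vector_scalar_commute right_diff_distrib)
    with 1 show ?thesis by (auto simp: eq_neg_iff_add_eq_0)
  qed
  then have "(B *v w) \<bullet> (B *v w) = 0" for w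
    by (simp flip: Re_cinner_vec)
  then have "B = 0" by (simp add: matrix_eq)
  then show ?thesis by (simp add: B_def hermitian_mat_def)
qed

subsection \<open>Functional calculus\<close>

text \<open>For the real part of \<open>cinner_vec\<close> a Hermitian matrix is a symmetric real
  operator, so the real spectral theorem applies.\<close>

lemma eigenspaces_span:
  assumes "hermitian_mat A"
  shows "span {v. \<exists>l. v \<in> eigenspace A l} = UNIV"
proof -
  have "v \<bullet> (A *v w) = (A *v v) \<bullet> w" for v w
    using assms cinner_vec_adjoint[of v A w] by (simp add: hermitian_mat_def flip: Re_cinner_vec)
  from symmetric_eigenvectors_span[OF linear_matrix_vector this]
  show ?thesis by (simp add: eigenspace_def scaleR_eq_smult)
qed

text \<open>Reduces identities of the functional calculus to scalar identities at each
  eigenvalue.\<close>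

lemma matrix_eq_on_eigenspaces:
  fixes A B C :: "complex^'n^'n"
  assumes "hermitian_mat A" and "\<And>l v. v \<in> eigenspace A l \<Longrightarrow> B *v v = C *v v"
  shows "B = C"
proof -
  have "B *v v = C *v v" for v
    by (rule linear_eq_on_span[OF linear_matrix_vector linear_matrix_vector,
          of "{v. \<exists>l. v \<in> eigenspace A l}"])
      (use assms(2) eigenspaces_span[OF assms(1)] in auto)
  then show ?thesis by (simp add: matrix_eq)
qed

lemma mat_fun_cong: "(\<And>l. l \<in> real_spectrum A \<Longrightarrow> f l = g l) \<Longrightarrow> mat_fun f A = mat_fun g A"
  by (simp add: mat_fun_def)

lemma mat_fun_mult:
  assumes "hermitian_mat A"
  shows "mat_fun f A ** mat_fun g A = mat_fun (\<lambda>x. f x * g x) A"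
  using assms
  by (intro matrix_eq_on_eigenspaces[OF assms])
    (simp add: mat_fun_eigenvector vector_scalar_commute vector_smult_assoc mult.commute
      flip: matrix_vector_mul_assoc)

lemma mat_fun_commute:
  "hermitian_mat A \<Longrightarrow> mat_fun f A ** mat_fun g A = mat_fun g A ** mat_fun f A"
  by (simp add: mat_fun_mult mult.commute)

lemma mat_fun_add: "mat_fun (\<lambda>x. f x + g x) A = mat_fun f A + mat_fun g A"
  by (simp add: mat_fun_def scaleR_add_left sum.distrib)

lemma mat_fun_scaleR: "mat_fun (\<lambda>x. c * f x) A = c *\<^sub>R mat_fun f A"
  by (simp add: mat_fun_def scaleR_sum_right)

lemma mat_fun_one: "hermitian_mat A \<Longrightarrow> mat_fun (\<lambda>_. 1) A = mat 1"
  by (rule matrix_eq_on_eigenspaces) (auto simp: mat_fun_eigenvector)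

lemma mat_fun_id:
  assumes "hermitian_mat A" shows "mat_fun (\<lambda>x. x) A = A"
proof (rule matrix_eq_on_eigenspaces[OF assms])
  fix l v assume "v \<in> eigenspace A l"
  then show "mat_fun (\<lambda>x. x) A *v v = A *v v"
    using mat_fun_eigenvector[OF assms, of v l "\<lambda>x. x"] by (simp add: eigenspace_def)
qed

text \<open>Pairings of eigenvectors decide: they vanish for distinct eigenvalues and carry the real
  factor \<open>f l\<close> for equal ones.\<close>

lemma hermitian_mat_fun:
  assumes "hermitian_mat A" shows "hermitian_mat (mat_fun f A)"
proof -
  have eq: "adjoint_mat (mat_fun f A) *v v = mat_fun f A *v v" if v: "v \<in> eigenspace A l" for v l
  proof -
    have "(adjoint_mat (mat_fun f A) *v v - mat_fun f A *v v) \<bullet> w = 0" for w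
    proof -
      have "orthogonal (adjoint_mat (mat_fun f A) *v v - mat_fun f A *v v) w" if "w \<in> eigenspace A m" for w m
      proof -
        have "cinner_vec (adjoint_mat (mat_fun f A) *v v) w = cinner_vec (mat_fun f A *v v) w"
          unfolding cinner_vec_adjoint[symmetric]
          using eigenspaces_orthogonal[OF assms v that]
          by (cases "l = m")
            (simp_all add: mat_fun_eigenvector[OF assms v] mat_fun_eigenvector[OF assms that] cinner_vec_simps)
        from arg_cong[OF this, of Re] show ?thesis
          by (simp add: orthogonal_def inner_diff_left Re_cinner_vec)
      qed
      then have "orthogonal (adjoint_mat (mat_fun f A) *v v - mat_fun f A *v v) w"
        using eigenspaces_span[OF assms] by (intro orthogonal_to_span[of w]) auto
      then show ?thesis by (simp add: orthogonal_def)
    qed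
    then show ?thesis by (metis eq_iff_diff_eq_0 inner_eq_zero_iff)
  qed
  then show ?thesis
    unfolding hermitian_mat_def by (rule matrix_eq_on_eigenspaces[OF assms])
qed

text \<open>The indicator form makes product rules instances of \<open>mat_fun_mult\<close>; outside
  the spectrum the value is 0.\<close>

definition spectral_proj :: "complex^'n^'n \<Rightarrow> real \<Rightarrow> complex^'n^'n" where
  "spectral_proj A l = mat_fun (\<lambda>x. of_bool (x = l)) A"

lemma mat_fun_mult_spectral_proj:
  assumes "hermitian_mat A"
  shows "mat_fun f A ** spectral_proj A l = f l *\<^sub>R spectral_proj A l"
    and "spectral_proj A l ** mat_fun f A = f l *\<^sub>R spectral_proj A l"
  unfolding spectral_proj_def mat_fun_mult[OF assms] mat_fun_scaleR[symmetric]
  by (auto intro: mat_fun_cong)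

lemma spectral_proj_mult:
  assumes "hermitian_mat A"
  shows "spectral_proj A l ** spectral_proj A m = (if l = m then spectral_proj A l else 0)"
proof -
  have "spectral_proj A l ** spectral_proj A m = of_bool (m = l) *\<^sub>R spectral_proj A m"
    by (subst spectral_proj_def) (rule mat_fun_mult_spectral_proj[OF assms])
  then show ?thesis by auto
qed

lemma mat_fun_eq_sum_spectral_proj:
  assumes "hermitian_mat A"
  shows "mat_fun f A = (\<Sum>l\<in>real_spectrum A. f l *\<^sub>R spectral_proj A l)"
proof -
  have "spectral_proj A l = matrix (orth_proj cinner_vec (eigenspace A l))" if "l \<in> real_spectrum A" for l
  proof -
    have "spectral_proj A l = (\<Sum>m\<in>real_spectrum A. if m = l then matrix (orth_proj cinner_vec (eigenspace A l)) else 0)"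
      unfolding spectral_proj_def mat_fun_def by (intro sum.cong) auto
    then show ?thesis using that finite_real_spectrum[OF assms] by simp
  qed
  then show ?thesis by (simp add: mat_fun_def)
qed

lemma real_spectrum_eigenvector:
  assumes "l \<in> real_spectrum A"
  obtains v where "v \<in> eigenspace A l" "v \<noteq> 0"
  using assms subspace_0[OF eigenspace_subspace[of A l]] by (auto simp: real_spectrum_def)

lemma spectral_proj_nonzero:
  assumes "hermitian_mat A" "l \<in> real_spectrum A"
  shows "spectral_proj A l \<noteq> 0"
proof -
  obtain v where "v \<in> eigenspace A l" "v \<noteq> 0" using real_spectrum_eigenvector[OF assms(2)] .
  then have "spectral_proj A l *v v \<noteq> 0"
    by (simp add: spectral_proj_def mat_fun_eigenvector[OF assms(1)])
  then show ?thesis by auto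
qed

lemma von_neumann_algebra_closed:
  fixes M :: "(complex^'n^'n) set"
  assumes "von_neumann_algebra M"
  shows "mat 1 \<in> M" "X \<in> M \<Longrightarrow> Y \<in> M \<Longrightarrow> X ** Y \<in> M" "X \<in> M \<Longrightarrow> adjoint_mat X \<in> M"
    "X \<in> M \<Longrightarrow> Y \<in> M \<Longrightarrow> X - Y \<in> M" "X \<in> M \<Longrightarrow> c *\<^sub>R X \<in> M" "(\<And>i. i \<in> I \<Longrightarrow> F i \<in> M) \<Longrightarrow> sum F I \<in> M"
  using assms von_neumann_algebra_subspace[OF assms]
  by (simp_all add: von_neumann_algebra_def subspace_diff subspace_scale subspace_sum)

text \<open>Spectral projections are Lagrange interpolation polynomials.\<close>

lemma mat_fun_in_algebra:
  assumes M: "von_neumann_algebra M" and A: "A \<in> M" "hermitian_mat A"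
  shows "mat_fun f A \<in> M"
proof -
  note closed = von_neumann_algebra_closed[OF M]
  have lagrange: "mat_fun (\<lambda>x. \<Prod>m\<in>S. (x - m) / (l - m)) A \<in> M" if "finite S" for S l
    using that
  proof (induction S)
    case empty
    then show ?case using closed(1) by (simp add: mat_fun_one[OF A(2)])
  next
    case (insert m S)
    have "mat_fun (\<lambda>x. (x - m) / (l - m)) A
        = mat_fun (\<lambda>x. 1 / (l - m) * x + - (m / (l - m)) * 1) A"
      by (rule mat_fun_cong) (simp add: diff_divide_distrib)
    also have "\<dots> = (1 / (l - m)) *\<^sub>R A - (m / (l - m)) *\<^sub>R mat 1"
      unfolding mat_fun_add mat_fun_scaleR by (simp add: mat_fun_one[OF A(2)] mat_fun_id[OF A(2)])
    finally have "mat_fun (\<lambda>x. (x - m) / (l - m)) A \<in> M"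
      using A closed by simp
    then have "mat_fun (\<lambda>x. (x - m) / (l - m)) A ** mat_fun (\<lambda>x. \<Prod>m\<in>S. (x - m) / (l - m)) A \<in> M"
      using insert closed by blast
    then show ?case using insert by (simp add: mat_fun_mult[OF A(2)])
  qed
  have "spectral_proj A l \<in> M" if l: "l \<in> real_spectrum A" for l
  proof -
    have "mat_fun (\<lambda>x. \<Prod>m\<in>real_spectrum A - {l}. (x - m) / (l - m)) A = spectral_proj A l"
      unfolding spectral_proj_def
    proof (rule mat_fun_cong)
      fix k assume k: "k \<in> real_spectrum A"
      show "(\<Prod>m\<in>real_spectrum A - {l}. (k - m) / (l - m)) = of_bool (k = l)"
        using k finite_real_spectrum[OF A(2)] by (auto intro!: prod.neutral prod_zero)
    qed
    then show ?thesis using lagrange[of "real_spectrum A - {l}" l] finite_real_spectrum[OF A(2)] by simp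
  qed
  then show ?thesis
    unfolding mat_fun_eq_sum_spectral_proj[OF A(2)] by (intro closed)
qed

text \<open>A complementary \<open>g\<close> with \<open>f^2 + g^2 = c^2\<close> on the spectrum
  makes the squared norms of \<open>X ** mat_fun f A\<close> and \<open>X ** mat_fun g A\<close> add
  up to that of \<open>c *\<^sub>R X\<close>. Adjoints give the other side.\<close>

lemma norm_mult_mat_fun_le:
  fixes A X :: "complex^'n^'n"
  assumes A: "hermitian_mat A" and f: "\<And>l. l \<in> real_spectrum A \<Longrightarrow> \<bar>f l\<bar> \<le> c"
    and c: "c \<ge> 0"
  shows "norm (X ** mat_fun f A) \<le> c * norm X" "norm (mat_fun f A ** X) \<le> c * norm X"
proof -
  have right: "norm (X ** mat_fun f A) \<le> c * norm X" for X :: "complex^'n^'n"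
  proof -
    define g where "g x = sqrt (c\<^sup>2 - (f x)\<^sup>2)" for x
    have sq: "(norm (X ** mat_fun h A))\<^sup>2 = X \<bullet> (X ** mat_fun (\<lambda>x. h x * h x) A)" for h
      by (simp add: dot_square_norm[symmetric] inner_matrix_mult_right hermitian_mat_fun[OF A]
          hermitian_adjoint mat_fun_mult[OF A] flip: matrix_mul_assoc)
    have "mat_fun (\<lambda>x. f x * f x) A + mat_fun (\<lambda>x. g x * g x) A = mat_fun (\<lambda>x. c\<^sup>2 * 1) A"
      unfolding mat_fun_add[symmetric]
    proof (rule mat_fun_cong)
      fix l assume "l \<in> real_spectrum A"
      then have "(f l)\<^sup>2 \<le> c\<^sup>2" using f c abs_le_square_iff[of "f l" c] by simp
      then have "g l * g l = c\<^sup>2 - f l * f l"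
        by (simp add: g_def power2_eq_square)
      then show "f l * f l + g l * g l = c\<^sup>2 * 1" by simp
    qed
    then have "X ** (mat_fun (\<lambda>x. f x * f x) A + mat_fun (\<lambda>x. g x * g x) A) = c\<^sup>2 *\<^sub>R X"
      unfolding mat_fun_scaleR by (simp add: mat_fun_one[OF A] matrix_mult_simps)
    then have "(norm (X ** mat_fun f A))\<^sup>2 + (norm (X ** mat_fun g A))\<^sup>2 = X \<bullet> (c\<^sup>2 *\<^sub>R X)"
      unfolding sq by (simp add: matrix_mult_simps flip: inner_add_right)
    also have "\<dots> = (c * norm X)\<^sup>2" by (simp add: dot_square_norm power_mult_distrib)
    finally have "(norm (X ** mat_fun f A))\<^sup>2 \<le> (c * norm X)\<^sup>2"
      using zero_le_power2[of "norm (X ** mat_fun g A)"] by linarith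
    then show ?thesis using c by (auto intro: power2_le_imp_le)
  qed
  then show "norm (X ** mat_fun f A) \<le> c * norm X" .
  have "norm (mat_fun f A ** X) = norm (adjoint_mat X ** mat_fun f A)"
    by (metis adjoint_mat_simps(2) hermitian_adjoint hermitian_mat_fun[OF A] norm_adjoint_mat)
  with right[of "adjoint_mat X"] show "norm (mat_fun f A ** X) \<le> c * norm X"
    by (simp add: norm_adjoint_mat)
qed

subsection \<open>Trace norm\<close>

text \<open>An eigenvector of \<open>A\<close> for \<open>l\<close> is one of \<open>A ** A\<close>
  for \<open>l^2\<close>, whose root is \<open>sgn l * l\<close>. The pairing with
  \<open>mat_fun sgn A\<close> suits Cauchy-Schwarz.\<close>

lemma trace_norm_hermitian:
  assumes A: "hermitian_mat A"
  shows "trace_norm A = mat_fun sgn A \<bullet> A"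
proof -
  have A2: "hermitian_mat (A ** A)"
    using A by (simp add: hermitian_mat_def adjoint_mat_simps)
  have "mat_powr (adjoint_mat A ** A) (1/2) = mat_fun (\<lambda>x. sgn x * x) A"
  proof (rule matrix_eq_on_eigenspaces[OF A])
    fix l v assume v: "v \<in> eigenspace A l"
    then have v2: "v \<in> eigenspace (A ** A) (l\<^sup>2)"
      by (simp add: eigenspace_def vector_scalar_commute vector_smult_assoc power2_eq_square
          flip: matrix_vector_mul_assoc)
    have "(l\<^sup>2) powr (1/2) = sgn l * l"
      by (simp add: powr_half_sqrt abs_sgn mult.commute)
    then show "mat_powr (adjoint_mat A ** A) (1/2) *v v = mat_fun (\<lambda>x. sgn x * x) A *v v"
      using mat_fun_eigenvector[OF A2 v2] mat_fun_eigenvector[OF A v]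
      by (simp add: mat_powr_def hermitian_adjoint[OF A])
  qed
  also have "\<dots> = mat_fun sgn A ** A"
    using mat_fun_mult[OF A, of sgn "\<lambda>x. x"] mat_fun_id[OF A] by simp
  finally show ?thesis
    by (simp add: trace_norm_def Re_trace_mult hermitian_mat_fun[OF A])
qed

text \<open>The absolute value of \<open>A\<close> is the square of the Hermitian \<open>?P\<close>,
  so its trace is a squared norm.\<close>

lemma trace_norm_nonneg:
  fixes A :: "complex^'n^'n"
  assumes A: "hermitian_mat A"
  shows "0 \<le> trace_norm A"
proof -
  let ?P = "mat_fun (\<lambda>x. sqrt \<bar>x\<bar>) A"
  have "mat_fun sgn A ** A = ?P ** ?P"
    using mat_fun_mult[OF A, of sgn "\<lambda>x. x"]
    by (simp add: mat_fun_id[OF A] mat_fun_mult[OF A]) (simp add: abs_sgn mult.commute)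
  then have "trace_norm A = ?P \<bullet> ?P"
    using Re_trace_mult[OF hermitian_mat_fun[OF A], of sgn A] Re_trace_mult[OF hermitian_mat_fun[OF A], of "\<lambda>x. sqrt \<bar>x\<bar>" ?P]
    by (simp add: trace_norm_hermitian[OF A])
  then show ?thesis by simp
qed

text \<open>The difference splits as
  \<open>adjoint_mat Y ** (Y - Z) + adjoint_mat (Y - Z) ** Z\<close>; multiplication by its sign
  matrix is a contraction, and Cauchy-Schwarz bounds both pairings.\<close>

lemma trace_norm_diff_squares_le:
  fixes Y Z :: "complex^'n^'n"
  shows "trace_norm (adjoint_mat Y ** Y - adjoint_mat Z ** Z) \<le> (norm Y + norm Z) * norm (Y - Z)"
proof -
  let ?A = "adjoint_mat Y ** Y - adjoint_mat Z ** Z" and ?B = "Y - Z"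
  have A: "hermitian_mat ?A" by (simp add: hermitian_mat_def adjoint_mat_simps)
  let ?S = "mat_fun sgn ?A"
  have S: "norm (X ** ?S) \<le> norm X" for X :: "complex^'n^'n"
    using norm_mult_mat_fun_le(1)[OF A, of sgn 1 X] by (simp add: sgn_if)
  have "?S \<bullet> ?A = ?S \<bullet> (adjoint_mat Y ** ?B) + ?S \<bullet> (adjoint_mat ?B ** Z)"
    by (simp add: adjoint_mat_simps matrix_mult_simps inner_simps)
  also have "\<dots> = (Y ** ?S) \<bullet> ?B + (?B ** ?S) \<bullet> Z"
    by (simp add: inner_matrix_mult_left)
  also have "\<dots> \<le> norm (Y ** ?S) * norm ?B + norm (?B ** ?S) * norm Z"
    by (intro add_mono norm_cauchy_schwarz)
  also have "\<dots> \<le> norm Y * norm ?B + norm ?B * norm Z"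
    by (intro add_mono mult_right_mono S) auto
  finally show ?thesis
    by (simp add: trace_norm_hermitian[OF A] algebra_simps)
qed

subsection \<open>Positive definite matrices and conditional expectations\<close>

text \<open>Positivity is put on the spectrum, where \<open>mat_fun\<close> evaluates functions, so
  laws for positive reals lift directly.\<close>

definition pos_def_mat :: "complex^'n^'n \<Rightarrow> bool" where
  "pos_def_mat A \<longleftrightarrow> hermitian_mat A \<and> (\<forall>l\<in>real_spectrum A. 0 < l)"

lemma pos_def_hermitian: "pos_def_mat A \<Longrightarrow> hermitian_mat A"
  by (simp add: pos_def_mat_def)

lemma hermitian_mat_powr: "pos_def_mat A \<Longrightarrow> hermitian_mat (mat_powr A p)"
  by (simp add: mat_powr_def hermitian_mat_fun pos_def_hermitian)

lemma mat_powr_mult: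
  assumes "pos_def_mat A" shows "mat_powr A p ** mat_powr A q = mat_powr A (p + q)"
  using assms by (simp add: mat_powr_def mat_fun_mult pos_def_hermitian powr_add)

lemma mat_powr_zero:
  assumes "pos_def_mat A" shows "mat_powr A 0 = mat 1"
proof -
  \<comment> \<open>\<open>0 powr 0\<close> is 0, so positivity of the spectrum matters
    here.\<close>
  have "mat_powr A 0 = mat_fun (\<lambda>_. 1) A"
    unfolding mat_powr_def using assms by (intro mat_fun_cong) (auto simp: pos_def_mat_def)
  then show ?thesis using assms by (simp add: mat_fun_one pos_def_hermitian)
qed

lemma mat_powr_one:
  assumes "pos_def_mat A" shows "mat_powr A 1 = A"
proof -
  have "mat_powr A 1 = mat_fun (\<lambda>x. x) A"
    unfolding mat_powr_def using assms by (intro mat_fun_cong) (auto simp: pos_def_mat_def)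
  then show ?thesis using assms by (simp add: mat_fun_id pos_def_hermitian)
qed

lemma matrix_inv_eq_mat_powr:
  fixes A :: "complex^'n^'n"
  assumes "pos_def_mat A" shows "matrix_inv A = mat_powr A (-1)"
proof -
  have *: "A ** mat_powr A (-1) = mat 1" "mat_powr A (-1) ** A = mat 1"
    using mat_powr_mult[OF assms, of 1 "-1"] mat_powr_mult[OF assms, of "-1" 1]
    by (simp_all add: mat_powr_one[OF assms] mat_powr_zero[OF assms])
  then have inv: "A ** matrix_inv A = mat 1"
    using someI[of "\<lambda>B. A ** B = mat 1 \<and> B ** A = mat 1"] unfolding matrix_inv_def by auto
  have "matrix_inv A = (mat_powr A (-1) ** A) ** matrix_inv A" by (simp add: *)
  also have "\<dots> = mat_powr A (-1)" by (simp add: inv flip: matrix_mul_assoc)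
  finally show ?thesis .
qed

lemma faithful_state_pos_def:
  fixes A :: "complex^'n^'n"
  assumes "faithful_state M A" shows "pos_def_mat A"
  unfolding pos_def_mat_def
proof (intro conjI ballI)
  have psd: "psd_mat A" using assms by (simp add: faithful_state_def)
  then show "hermitian_mat A" by (rule psd_mat_hermitian)
  fix l assume "l \<in> real_spectrum A"
  then obtain v where v: "v \<in> eigenspace A l" "v \<noteq> 0" using real_spectrum_eigenvector by blast
  then have Av: "A *v v = l *\<^sub>R v" by (simp add: eigenspace_def scaleR_eq_smult)
  have "0 \<le> v \<bullet> (A *v v)"
    using psd by (auto simp: psd_mat_def complex_nonneg_Reals_iff simp flip: Re_cinner_vec)
  then have "0 \<le> l" using v by (auto simp: Av zero_le_mult_iff dot_square_norm)
  moreover have "l \<noteq> 0"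
  proof
    assume "l = 0"
    then have "A *v v = 0" by (simp add: Av)
    moreover obtain B where "B ** A = mat 1"
      using assms by (auto simp: faithful_state_def invertible_def)
    ultimately have "v = 0"
      by (metis matrix_vector_mul_assoc matrix_vector_mul_lid matrix_vector_mult_0_right)
    then show False using v by simp
  qed
  ultimately show "0 < l" by simp
qed

lemma eigenvalue_le_op_norm:
  fixes A :: "complex^'n^'n"
  assumes "l \<in> real_spectrum A" shows "\<bar>l\<bar> \<le> op_norm A"
proof -
  obtain v where "v \<in> eigenspace A l" "v \<noteq> 0" using real_spectrum_eigenvector[OF assms] .
  then show ?thesis
    using norm_matrix_vector_le[of A v] by (simp add: eigenspace_def flip: scaleR_eq_smult)
qed

lemma cond_exp_tr_inner:
  fixes N :: "(complex^'n^'n) set"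
  assumes "von_neumann_algebra N"
  shows "cond_exp_tr N X \<in> N" "Z \<in> N \<Longrightarrow> Z \<bullet> cond_exp_tr N X = Z \<bullet> X"
proof -
  have *: "cond_exp_tr N X \<in> N \<and> (\<forall>Z\<in>N. hs_inner Z (X - cond_exp_tr N X) = 0)"
    using cond_exp_tr_characterization[OF assms, of X "cond_exp_tr N X"] by simp
  then show "cond_exp_tr N X \<in> N" by simp
  assume "Z \<in> N"
  with * have "Z \<bullet> (X - cond_exp_tr N X) = 0" by (simp flip: Re_hs_inner)
  then show "Z \<bullet> cond_exp_tr N X = Z \<bullet> X" by (simp add: inner_diff_right)
qed

text \<open>The difference of \<open>?B\<close> and its adjoint lies in \<open>N\<close> and is
  orthogonal to itself. For an eigenvalue \<open>l\<close>, pairing with \<open>?E\<close>, an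
  element of \<open>N\<close>, equates \<open>l\<close> times the squared norm of \<open>?E\<close>
  with that of \<open>?E ** ?r\<close>.\<close>

lemma pos_def_cond_exp:
  fixes N :: "(complex^'n^'n) set"
  assumes N: "von_neumann_algebra N" and A: "pos_def_mat A"
  shows "pos_def_mat (cond_exp_tr N A)"
proof -
  let ?B = "cond_exp_tr N A"
  note closed = von_neumann_algebra_closed[OF N]
  note B = cond_exp_tr_inner[OF N, where X = A]
  have "(adjoint_mat ?B - ?B) \<bullet> (adjoint_mat ?B - ?B) = 0"
  proof -
    define Z where "Z = adjoint_mat ?B - ?B"
    have Z: "Z \<in> N" "adjoint_mat Z \<in> N" using B closed by (auto simp: Z_def)
    have "Z \<bullet> adjoint_mat ?B = adjoint_mat Z \<bullet> ?B"
      by (metis adjoint_mat_simps(1) inner_adjoint_mat)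
    also have "\<dots> = Z \<bullet> A"
      by (metis B(2) Z(2) A hermitian_adjoint pos_def_hermitian inner_adjoint_mat)
    finally show ?thesis
      using B(2)[OF Z(1)] by (simp add: Z_def[symmetric] inner_diff_right[of Z "adjoint_mat ?B" ?B, folded Z_def])
  qed
  then have hB: "hermitian_mat ?B" by (simp add: hermitian_mat_def)
  have "0 < l" if l: "l \<in> real_spectrum ?B" for l
  proof -
    let ?E = "spectral_proj ?B l" and ?r = "mat_powr A (1/2)" and ?s = "mat_powr A (-1/2)"
    have E: "?E \<in> N" "?E \<noteq> 0" "?E ** ?E = ?E" "adjoint_mat ?E = ?E"
      using mat_fun_in_algebra[OF N B(1) hB] spectral_proj_nonzero[OF hB l] spectral_proj_mult[OF hB]
        hermitian_mat_fun[OF hB] by (auto simp: spectral_proj_def hermitian_mat_def)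
    have rs: "?r ** ?s = mat 1" "?r ** ?r = A"
      using mat_powr_mult[OF A, of "1/2" "-1/2"] mat_powr_mult[OF A, of "1/2" "1/2"]
      by (simp_all add: mat_powr_zero[OF A] mat_powr_one[OF A])
    have nz: "?E ** ?r \<noteq> 0"
    proof
      assume "?E ** ?r = 0"
      then have "?E ** ?r ** ?s = 0" by simp
      then show False using E(2) rs by (simp flip: matrix_mul_assoc)
    qed
    have "?E \<bullet> ?B = (?E ** ?E) \<bullet> ?B" by (simp add: E)
    also have "\<dots> = ?E \<bullet> (?E ** ?B)" by (simp only: inner_matrix_mult_left E(4))
    also have "\<dots> = l * (?E \<bullet> ?E)"
      using mat_fun_mult_spectral_proj(2)[OF hB, of l "\<lambda>x. x"] by (simp add: mat_fun_id[OF hB])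
    finally have "l * (?E \<bullet> ?E) = ?E \<bullet> A" using B(2)[OF E(1)] by simp
    also have "\<dots> = ?E \<bullet> (?r ** ?r)" by (simp add: rs)
    also have "\<dots> = (?E ** ?r) \<bullet> ?r"
      by (simp only: inner_matrix_mult_right hermitian_adjoint[OF hermitian_mat_powr[OF A]])
    also have "\<dots> = (?E ** (?E ** ?r)) \<bullet> ?r" by (simp add: E matrix_mul_assoc)
    also have "\<dots> = (?E ** ?r) \<bullet> (?E ** ?r)" by (simp only: inner_matrix_mult_left E(4))
    also have "\<dots> > 0" using nz by simp
    finally show ?thesis using E(2) by (simp add: zero_less_mult_iff dot_square_norm)
  qed
  then show ?thesis using hB by (simp add: pos_def_mat_def)
qed

subsection \<open>Entropy and recovery\<close>

lemma powr_minus_half: "0 < x \<Longrightarrow> x powr (-1/2) = 1 / sqrt x" for x :: real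
  using powr_minus_divide[of x "1/2"] by (simp add: powr_half_sqrt)

text \<open>\<open>S\<close> and \<open>R\<close> are the conditional expectations onto \<open>N\<close> of \<open>\<sigma>\<close> and \<open>\<rho>\<close>. The case \<open>N = M\<close>, where
  \<open>S = \<sigma>\<close> and \<open>R = \<rho>\<close>, is used as well.\<close>

locale compressed_states =
  fixes M N :: "(complex^'n^'n) set" and \<rho> \<sigma> R S :: "complex^'n^'n"
  assumes M: "von_neumann_algebra M" and N: "von_neumann_algebra N" and NM: "N \<subseteq> M"
    and mem: "\<rho> \<in> M" "\<sigma> \<in> M" "R \<in> N" "S \<in> N"
    and pd: "pos_def_mat \<rho>" "pos_def_mat \<sigma>" "pos_def_mat R" "pos_def_mat S"
    and trace_one: "trace \<rho> = 1"
    and inner_R: "Z \<in> N \<Longrightarrow> Z \<bullet> R = Z \<bullet> \<rho>" and inner_S: "Z \<in> N \<Longrightarrow> Z \<bullet> S = Z \<bullet> \<sigma>"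
begin

text \<open>The image under the isometry \<open>X \<mapsto> X R\<^sup>-\<^sup>1\<^sup>/\<^sup>2 \<rho>\<^sup>1\<^sup>/\<^sup>2\<close> of the spectral component of \<open>R\<^sup>1\<^sup>/\<^sup>2\<close> for the
  eigenvalue \<open>l / m\<close> of \<open>\<Delta>\<^sub>S\<^sub>,\<^sub>R\<close>.\<close>

definition component :: "real \<times> real \<Rightarrow> complex^'n^'n" where
  "component p = spectral_proj S (fst p) ** spectral_proj R (snd p) ** mat_powr \<rho> (1/2)"

abbreviation spec :: "(real \<times> real) set" where
  "spec \<equiv> real_spectrum S \<times> real_spectrum R"

lemmas herm = pd[THEN pos_def_hermitian]
lemmas closed_N = von_neumann_algebra_closed[OF N]
lemmas closed_M = von_neumann_algebra_closed[OF M]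

lemma spec_pos: "p \<in> spec \<Longrightarrow> 0 < fst p" "p \<in> spec \<Longrightarrow> 0 < snd p"
  using pd by (auto simp: pos_def_mat_def)

lemma finite_spec: "finite spec"
  by (simp add: finite_real_spectrum herm)

lemma adjoint_mat_powr_rho: "adjoint_mat (mat_powr \<rho> p) = mat_powr \<rho> p"
  by (simp add: hermitian_adjoint hermitian_mat_powr pd)

lemma adjoint_spectral_proj:
  "adjoint_mat (spectral_proj R l) = spectral_proj R l" "adjoint_mat (spectral_proj S l) = spectral_proj S l"
  by (simp_all add: spectral_proj_def hermitian_adjoint hermitian_mat_fun herm)

lemma sqrt_rho_mult: "mat_powr \<rho> (1/2) ** mat_powr \<rho> (1/2) = \<rho>"
  using mat_powr_mult[OF pd(1), of "1/2" "1/2"] by (simp add: mat_powr_one pd)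

section \<open>Compression to the subalgebra\<close>

text \<open>\<open>\<rho>\<close> ends up paired with \<open>adjoint_mat Y ** X\<close>, an element
  of \<open>N\<close>, and may be replaced by \<open>R\<close>. Inserting
  \<open>mat_powr R (-1/2)\<close> to the right of \<open>X\<close> and \<open>Y\<close> gives the
  isometry property.\<close>

lemma inner_compression:
  assumes "X \<in> N" "Y \<in> N"
  shows "(X ** mat_powr \<rho> (1/2)) \<bullet> (Y ** mat_powr \<rho> (1/2)) = X \<bullet> (Y ** R)"
proof -
  have "(X ** mat_powr \<rho> (1/2)) \<bullet> (Y ** mat_powr \<rho> (1/2)) = X \<bullet> (Y ** \<rho>)"
    by (simp add: inner_matrix_mult_right adjoint_mat_powr_rho sqrt_rho_mult flip: matrix_mul_assoc)
  also have "\<dots> = (adjoint_mat Y ** X) \<bullet> \<rho>"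
    by (simp add: inner_matrix_mult_left adjoint_mat_simps)
  also have "\<dots> = (adjoint_mat Y ** X) \<bullet> R"
    using assms closed_N inner_R by simp
  also have "\<dots> = X \<bullet> (Y ** R)"
    by (simp add: inner_matrix_mult_left adjoint_mat_simps)
  finally show ?thesis .
qed

text \<open>The powers of \<open>\<rho>\<close> cancel, and \<open>\<sigma>\<close>, paired with
  \<open>X ** adjoint_mat Y\<close> in \<open>N\<close>, becomes \<open>S\<close>.\<close>

lemma inner_modular_compression:
  assumes "X \<in> N" "Y \<in> N"
  shows "(X ** mat_powr \<rho> (1/2)) \<bullet> rel_modular \<sigma> \<rho> (Y ** mat_powr \<rho> (1/2)) = X \<bullet> (S ** Y)"
proof -
  have "mat_powr \<rho> (1/2) ** matrix_inv \<rho> ** mat_powr \<rho> (1/2) = mat 1"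
    using mat_powr_mult[OF pd(1), of "1/2" "-1"] mat_powr_mult[OF pd(1), of "-1/2" "1/2"]
    by (simp add: matrix_inv_eq_mat_powr pd mat_powr_zero)
  then have "(X ** mat_powr \<rho> (1/2)) \<bullet> rel_modular \<sigma> \<rho> (Y ** mat_powr \<rho> (1/2)) = X \<bullet> (\<sigma> ** Y)"
    by (simp add: rel_modular_def inner_matrix_mult_right adjoint_mat_powr_rho flip: matrix_mul_assoc)
  also have "\<dots> = (X ** adjoint_mat Y) \<bullet> \<sigma>"
    by (simp add: inner_matrix_mult_right adjoint_mat_simps)
  also have "\<dots> = (X ** adjoint_mat Y) \<bullet> S"
    using assms closed_N inner_S by simp
  also have "\<dots> = X \<bullet> (S ** Y)"
    by (simp add: inner_matrix_mult_right adjoint_mat_simps)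
  finally show ?thesis .
qed

lemma proj_in_N: "spectral_proj S l ** spectral_proj R m \<in> N"
  unfolding spectral_proj_def by (intro closed_N mat_fun_in_algebra[OF N] mem herm)

lemma component_in_M: "component p \<in> M"
  unfolding component_def mat_powr_def
  by (intro closed_M mat_fun_in_algebra[OF M] mem herm subsetD[OF NM proj_in_N])

lemma proj_mult:
  "S ** spectral_proj S l = l *\<^sub>R spectral_proj S l" "spectral_proj R m ** R = m *\<^sub>R spectral_proj R m"
  using mat_fun_mult_spectral_proj(1)[OF herm(4), of "\<lambda>x. x" l]
    mat_fun_mult_spectral_proj(2)[OF herm(3), of m "\<lambda>x. x"]
  by (simp_all add: mat_fun_id herm)

section \<open>Spectral sums for the compressed modular operator\<close>

lemma inner_component:
  "component p \<bullet> component q = snd q *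
    ((spectral_proj S (fst p) ** spectral_proj R (snd p)) \<bullet> (spectral_proj S (fst q) ** spectral_proj R (snd q)))"
  unfolding component_def inner_compression[OF proj_in_N proj_in_N]
  by (simp add: proj_mult matrix_mult_simps flip: matrix_mul_assoc)

lemma component_orthogonal: "pairwise (\<lambda>p q. component p \<bullet> component q = 0) spec"
proof (rule pairwiseI)
  fix p q :: "real \<times> real"
  assume "p \<noteq> q"
  obtain l m l' m' where [simp]: "p = (l, m)" "q = (l', m')" by (metis surj_pair)
  have "(spectral_proj S l ** spectral_proj R m) \<bullet> (spectral_proj S l' ** spectral_proj R m') = 0"
  proof (cases "l = l'")
    case False
    then show ?thesis
      by (simp add: inner_matrix_mult_left adjoint_spectral_proj matrix_mul_assoc spectral_proj_mult herm)
  next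
    case True
    with \<open>p \<noteq> q\<close> show ?thesis
      by (simp add: inner_matrix_mult_right adjoint_spectral_proj spectral_proj_mult herm flip: matrix_mul_assoc)
  qed
  then show "component p \<bullet> component q = 0" by (simp add: inner_component)
qed

text \<open>\<open>S\<close> contributes \<open>fst q\<close>, while the inner product carries
  \<open>snd q\<close> from \<open>R\<close>. Only pairings are described: a component need not be
  an eigenvector when \<open>N\<close> is smaller than \<open>M\<close>.\<close>

lemma modular_component:
  assumes "q \<in> spec"
  shows "component p \<bullet> rel_modular \<sigma> \<rho> (component q) = fst q / snd q * (component p \<bullet> component q)"
  using spec_pos[OF assms] unfolding inner_component
  unfolding component_def inner_modular_compression[OF proj_in_N proj_in_N]
  by (simp add: proj_mult matrix_mult_simps matrix_mul_assoc)

text \<open>Joint functional calculus of left multiplication by \<open>S\<close> and right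
  multiplication by \<open>R\<close>, which commute.\<close>

lemma sum_component:
  "(\<Sum>p\<in>spec. (f (fst p) * g (snd p)) *\<^sub>R component p) = mat_fun f S ** mat_fun g R ** mat_powr \<rho> (1/2)"
proof -
  have "mat_fun f S ** mat_fun g R ** mat_powr \<rho> (1/2)
    = (\<Sum>l\<in>real_spectrum S. \<Sum>m\<in>real_spectrum R. (f l * g m) *\<^sub>R component (l, m))"
    unfolding mat_fun_eq_sum_spectral_proj[OF herm(3)] mat_fun_eq_sum_spectral_proj[OF herm(4)]
    by (simp add: component_def matrix_mult_simps mult.commute scaleR_sum_right) (rule sum.swap)
  then show ?thesis by (simp add: sum.cartesian_product split_def)
qed

lemma sum_component_one: "(\<Sum>p\<in>spec. component p) = mat_powr \<rho> (1/2)"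
  using sum_component[of "\<lambda>_. 1" "\<lambda>_. 1"] by (simp add: mat_fun_one herm)

lemma sum_component_sqrt:
  "(\<Sum>p\<in>spec. sqrt (fst p / snd p) *\<^sub>R component p) = mat_powr S (1/2) ** mat_powr R (-1/2) ** mat_powr \<rho> (1/2)"
  unfolding mat_powr_def[of S] mat_powr_def[of R] sum_component[symmetric]
proof (rule sum.cong)
  fix p assume "p \<in> spec"
  from spec_pos[OF this] show "sqrt (fst p / snd p) *\<^sub>R component p
      = (fst p powr (1/2) * snd p powr (-1/2)) *\<^sub>R component p"
    by (simp only: real_sqrt_divide powr_minus_half powr_half_sqrt[OF less_imp_le]) simp
qed simp

text \<open>The logarithm of the quotient splits, and \<open>inner_compression\<close> with
  \<open>mat 1\<close> turns the pairing into a trace against \<open>R\<close>. The case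
  \<open>N = M\<close> yields the entropy of \<open>\<rho>\<close> and
  \<open>\<sigma>\<close>.\<close>

lemma sum_component_ln:
  "(\<Sum>p\<in>spec. ln (fst p / snd p) *\<^sub>R component p) \<bullet> mat_powr \<rho> (1/2) = - relative_entropy R S"
proof -
  have "(\<Sum>p\<in>spec. ln (fst p / snd p) *\<^sub>R component p)
      = (\<Sum>p\<in>spec. (ln (fst p) * 1) *\<^sub>R component p - (1 * ln (snd p)) *\<^sub>R component p)"
  proof (rule sum.cong)
    fix p assume "p \<in> spec"
    from spec_pos[OF this] show "ln (fst p / snd p) *\<^sub>R component p
        = (ln (fst p) * 1) *\<^sub>R component p - (1 * ln (snd p)) *\<^sub>R component p"
      by (simp add: ln_div scaleR_diff_left)
  qed simp
  also have "\<dots> = (mat_log S - mat_log R) ** mat_powr \<rho> (1/2)"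
    unfolding sum_subtractf sum_component[of ln "\<lambda>_. 1"] sum_component[of "\<lambda>_. 1" ln]
    by (simp add: mat_fun_one herm mat_log_def matrix_mult_simps)
  also have "\<dots> \<bullet> mat_powr \<rho> (1/2) = (mat_log S - mat_log R) \<bullet> R"
    using inner_compression[of "mat_log S - mat_log R" "mat 1"] closed_N
      mat_fun_in_algebra[OF N mem(3) herm(3)] mat_fun_in_algebra[OF N mem(4) herm(4)]
    by (simp add: mat_log_def)
  also have "\<dots> = - relative_entropy R S"
    by (simp add: relative_entropy_def Re_trace_mult herm inner_diff_left inner_diff_right inner_commute)
  finally show ?thesis .
qed

section \<open>Norm and positivity of the relative modular operator\<close>

abbreviation "modular_norm \<equiv> hs_op_norm_on M (rel_modular \<sigma> \<rho>)"

lemma linear_rel_modular: "linear (rel_modular \<sigma> \<rho>)"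
  by (rule linearI) (simp_all add: rel_modular_def matrix_mult_simps)

lemma norm_rel_modular_le:
  assumes "X \<in> M" shows "norm (rel_modular \<sigma> \<rho> X) \<le> modular_norm * norm X"
proof (cases "X = 0")
  case False
  \<comment> \<open>A linear map in finite dimension is bounded, so the supremum in
    \<open>hs_op_norm_on\<close> is a genuine upper bound.\<close>
  obtain B where B: "\<And>Y. norm (rel_modular \<sigma> \<rho> Y) \<le> norm Y * B"
    using bounded_linear.bounded linear_rel_modular linear_conv_bounded_linear by metis
  have "bdd_above ((\<lambda>X. hs_norm (rel_modular \<sigma> \<rho> X) / hs_norm X) ` (M - {0}))"
    using B by (intro bdd_aboveI2[of _ _ B]) (simp add: hs_norm_eq_norm divide_le_eq mult.commute)
  then have "hs_norm (rel_modular \<sigma> \<rho> X) / hs_norm X \<le> modular_norm"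
    unfolding hs_op_norm_on_def using assms False by (intro cSUP_upper) auto
  then show ?thesis using False by (simp add: hs_norm_eq_norm divide_le_eq)
qed (simp add: linear_0[OF linear_rel_modular])

text \<open>The quotient is the Rayleigh quotient of a nonzero component, an element of
  \<open>M\<close>.\<close>

lemma spec_le:
  assumes "p \<in> spec" "component p \<noteq> 0" shows "fst p / snd p \<le> modular_norm"
proof -
  have "fst p / snd p * (norm (component p))\<^sup>2 = component p \<bullet> rel_modular \<sigma> \<rho> (component p)"
    by (simp add: modular_component[OF assms(1)] dot_square_norm)
  also have "\<dots> \<le> norm (component p) * (modular_norm * norm (component p))"
    by (intro order_trans[OF norm_cauchy_schwarz] mult_left_mono norm_rel_modular_le component_in_M) auto
  also have "\<dots> = modular_norm * (norm (component p))\<^sup>2" by (simp add: power2_eq_square)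
  finally show ?thesis
    by (rule mult_right_le_imp_le) (use assms(2) in simp)
qed

lemma norm_sqrt_rho: "norm (mat_powr \<rho> (1/2)) = 1"
proof -
  have "mat_powr \<rho> (1/2) \<bullet> mat_powr \<rho> (1/2) = Re (trace \<rho>)"
    using Re_trace_mult[OF hermitian_mat_powr[OF pd(1)], of "1/2" "mat_powr \<rho> (1/2)"]
    by (simp add: sqrt_rho_mult)
  then show ?thesis by (simp add: norm_eq_sqrt_inner trace_one)
qed

lemma modular_norm_pos: "modular_norm > 0"
proof -
  have "\<exists>p\<in>spec. component p \<noteq> 0"
  proof (rule ccontr)
    assume "\<not> (\<exists>p\<in>spec. component p \<noteq> 0)"
    then have "(\<Sum>p\<in>spec. component p) = 0" by (intro sum.neutral) blast
    then have "mat_powr \<rho> (1/2) = 0" by (simp only: sum_component_one)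
    then show False using norm_sqrt_rho by simp
  qed
  then obtain p where p: "p \<in> spec" "component p \<noteq> 0" by blast
  have "0 < fst p / snd p" using spec_pos[OF p(1)] by simp
  with spec_le[OF p] show ?thesis by simp
qed

lemma ambient: "compressed_states M M \<rho> \<sigma> \<rho> \<sigma>"
  by unfold_locales (use M mem pd trace_one in auto)

text \<open>For \<open>N = M\<close> the square root of \<open>\<rho>\<close> commutes with
  \<open>matrix_inv \<rho>\<close>, so components are genuine eigenvectors, as
  \<open>spectral_sum_difference_bound\<close> demands of its first family.\<close>

lemma modular_component_ambient:
  assumes "p \<in> real_spectrum \<sigma> \<times> real_spectrum \<rho>"
  shows "rel_modular \<sigma> \<rho> (compressed_states.component \<rho> \<rho> \<sigma> p)
    = (fst p / snd p) *\<^sub>R compressed_states.component \<rho> \<rho> \<sigma> p"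
proof -
  interpret amb: compressed_states M M \<rho> \<sigma> \<rho> \<sigma> by (rule ambient)
  have "mat_powr \<rho> (1/2) ** matrix_inv \<rho> = matrix_inv \<rho> ** mat_powr \<rho> (1/2)"
    unfolding matrix_inv_eq_mat_powr[OF pd(1)] mat_powr_def by (rule mat_fun_commute[OF herm(1)])
  moreover have "spectral_proj \<rho> m ** (matrix_inv \<rho> ** B) = (1 / m) *\<^sub>R (spectral_proj \<rho> m ** B)"
    if "m > 0" for m and B :: "complex^'n^'n"
    using mat_fun_mult_spectral_proj(2)[OF herm(1), of m "\<lambda>x. x powr (-1)"] that
    by (simp add: matrix_mul_assoc matrix_inv_eq_mat_powr pd mat_powr_def powr_minus_divide matrix_mult_simps)
  ultimately show ?thesis
    using amb.spec_pos[OF assms] amb.proj_mult(1)[of "fst p"]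
    unfolding rel_modular_def amb.component_def
    by (simp add: matrix_mul_assoc) (simp add: matrix_mult_simps flip: matrix_mul_assoc)
qed

text \<open>Splitting off square roots turns the pairing into the squared norm of
  \<open>r ** X ** s\<close>.\<close>

lemma rel_modular_psd: "0 \<le> X \<bullet> rel_modular \<sigma> \<rho> X"
proof -
  define r where "r = mat_powr \<sigma> (1/2)"
  define s where "s = mat_powr \<rho> (-1/2)"
  have rs: "r ** r = \<sigma>" "s ** s = matrix_inv \<rho>" "adjoint_mat r = r" "adjoint_mat s = s"
    using mat_powr_mult[OF pd(2), of "1/2" "1/2"] mat_powr_mult[OF pd(1), of "-1/2" "-1/2"]
    by (simp_all add: r_def s_def mat_powr_one matrix_inv_eq_mat_powr pd hermitian_adjoint hermitian_mat_powr)
  have "rel_modular \<sigma> \<rho> X = r ** (r ** X ** s ** s)"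
    unfolding rel_modular_def rs(1,2)[symmetric] by (simp only: matrix_mul_assoc)
  then have "X \<bullet> rel_modular \<sigma> \<rho> X = (r ** X) \<bullet> (r ** X ** s ** s)"
    by (simp only: inner_matrix_mult_left[of r X] rs)
  also have "\<dots> = (r ** X ** s) \<bullet> (r ** X ** s)"
    by (simp only: inner_matrix_mult_right[of "r ** X" s] rs)
  finally show ?thesis by simp
qed

lemma rel_modular_symmetric: "X \<bullet> rel_modular \<sigma> \<rho> Y = rel_modular \<sigma> \<rho> X \<bullet> Y"
  by (simp add: rel_modular_def inner_matrix_mult_right[of "\<sigma> ** X"] inner_matrix_mult_left[of _ X]
      matrix_inv_eq_mat_powr pd adjoint_mat_powr_rho hermitian_adjoint herm matrix_mul_assoc)

text \<open>In \<open>spectral_sum_difference_bound\<close>, \<open>e\<close> is the component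
  family for \<open>N = M\<close> and \<open>h\<close> the one for \<open>N\<close>; both sum to the
  unit vector \<open>mat_powr \<rho> (1/2)\<close>.\<close>

theorem entropy_difference_bound:
  "(pi / 4) ^ 4 * norm (mat_powr S (1/2) ** mat_powr R (-1/2) ** mat_powr \<rho> (1/2) - mat_powr \<sigma> (1/2)) ^ 4
    \<le> modular_norm\<^sup>2 * (relative_entropy \<rho> \<sigma> - relative_entropy R S)"
proof -
  interpret amb: compressed_states M M \<rho> \<sigma> \<rho> \<sigma> by (rule ambient)
  have "mat_powr \<rho> (-1/2) ** mat_powr \<rho> (1/2) = mat 1"
    using mat_powr_mult[OF pd(1), of "-1/2" "1/2"] by (simp add: mat_powr_zero pd)
  then have sq: "(\<Sum>p\<in>amb.spec. sqrt (fst p / snd p) *\<^sub>R amb.component p) = mat_powr \<sigma> (1/2)"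
    unfolding amb.sum_component_sqrt by (simp flip: matrix_mul_assoc)
  show ?thesis
    using spectral_sum_difference_bound[OF linear_rel_modular rel_modular_symmetric rel_modular_psd
        amb.finite_spec amb.component_orthogonal finite_spec component_orthogonal _ _
        modular_component_ambient modular_component amb.sum_component_one sum_component_one
        norm_sqrt_rho amb.spec_le spec_le modular_norm_pos]
      amb.spec_pos spec_pos
    unfolding sq amb.sum_component_ln sum_component_ln sum_component_sqrt by simp
qed

text \<open>The factor 2 is the sum of the norms of the unit vectors \<open>Y\<close> and
  \<open>mat_powr \<rho> (1/2)\<close>; the two roots bound left multiplication by
  \<open>X\<close>.\<close>

lemma trace_norm_recovery_le:
  "trace_norm (mat_powr \<sigma> (1/2) ** mat_powr S (-1/2) ** R ** mat_powr S (-1/2) ** mat_powr \<sigma> (1/2) - \<rho>)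
    \<le> 2 * (sqrt (op_norm R) * sqrt (op_norm (matrix_inv S))
      * norm (mat_powr S (1/2) ** mat_powr R (-1/2) ** mat_powr \<rho> (1/2) - mat_powr \<sigma> (1/2)))"
proof -
  define X where "X = mat_powr R (1/2) ** mat_powr S (-1/2)"
  define Y where "Y = X ** mat_powr \<sigma> (1/2)"
  define V where "V = mat_powr S (1/2) ** mat_powr R (-1/2) ** mat_powr \<rho> (1/2) - mat_powr \<sigma> (1/2)"
  have adj: "adjoint_mat (mat_powr A p) = mat_powr A p" if "pos_def_mat A" for A :: "complex^'n^'n" and p
    by (simp add: hermitian_adjoint hermitian_mat_powr that)
  have half: "mat_powr A (1/2) ** mat_powr A (1/2) = A"
    and inv: "mat_powr A (1/2) ** mat_powr A (- (1/2)) = mat 1" "mat_powr A (- (1/2)) ** mat_powr A (1/2) = mat 1"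
    if "pos_def_mat A" for A :: "complex^'n^'n"
    using mat_powr_mult[OF that, of "1/2" "1/2"] mat_powr_mult[OF that, of "1/2" "-1/2"]
      mat_powr_mult[OF that, of "-1/2" "1/2"]
    by (simp_all add: mat_powr_zero mat_powr_one that)
  have R_eq: "R = mat_powr R (1/2) ** mat_powr R (1/2)" by (simp add: half pd)
  have petz: "mat_powr \<sigma> (1/2) ** mat_powr S (-1/2) ** R ** mat_powr S (-1/2) ** mat_powr \<sigma> (1/2)
      = adjoint_mat Y ** Y"
    unfolding Y_def X_def by (subst R_eq) (simp add: adjoint_mat_simps adj pd matrix_mul_assoc)
  have XN: "adjoint_mat X ** X \<in> N"
    unfolding X_def mat_powr_def by (intro closed_N mat_fun_in_algebra[OF N] mem herm)
  \<comment> \<open>\<open>\<sigma>\<close> is paired with an element of \<open>N\<close> and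
    becomes \<open>S\<close>; then the powers of \<open>S\<close> cancel and the trace of
    \<open>R\<close> remains.\<close>
  have "Y \<bullet> Y = X \<bullet> (X ** \<sigma>)"
    by (simp add: Y_def inner_matrix_mult_right adj half pd flip: matrix_mul_assoc)
  also have "\<dots> = (adjoint_mat X ** X) \<bullet> \<sigma>"
    by (simp add: inner_matrix_mult_left adjoint_mat_simps)
  also have "\<dots> = (adjoint_mat X ** X) \<bullet> S"
    by (simp only: inner_S[OF XN])
  also have "\<dots> = X \<bullet> (X ** mat_powr S (1/2) ** mat_powr S (1/2))"
    by (simp add: inner_matrix_mult_left adjoint_mat_simps half pd flip: matrix_mul_assoc)
  also have "\<dots> = (X ** mat_powr S (1/2)) \<bullet> (X ** mat_powr S (1/2))"
    by (simp add: inner_matrix_mult_right[of X "mat_powr S (1/2)"] adj pd)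
  also have "X ** mat_powr S (1/2) = mat_powr R (1/2)"
    by (simp add: X_def inv pd flip: matrix_mul_assoc)
  also have "mat_powr R (1/2) \<bullet> mat_powr R (1/2) = mat 1 \<bullet> R"
    using inner_matrix_mult_left[of "mat_powr R (1/2)" "mat 1" "mat_powr R (1/2)"] by (simp add: adj half pd)
  also have "\<dots> = mat 1 \<bullet> \<rho>" by (intro inner_R closed_N)
  also have "\<dots> = 1"
    using Re_trace_mult[of "mat 1" \<rho>] by (simp add: hermitian_mat_def adjoint_mat_simps trace_one)
  finally have Y1: "norm Y = 1" by (simp add: norm_eq_sqrt_inner)
  have "Y - mat_powr \<rho> (1/2) = - (X ** V)"
  proof -
    have "X ** (mat_powr S (1/2) ** mat_powr R (-1/2) ** mat_powr \<rho> (1/2))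
        = mat_powr R (1/2) ** (mat_powr S (-1/2) ** mat_powr S (1/2)) ** mat_powr R (-1/2) ** mat_powr \<rho> (1/2)"
      by (simp add: X_def matrix_mul_assoc)
    also have "\<dots> = mat_powr \<rho> (1/2)" by (simp add: inv pd)
    finally show ?thesis by (simp add: Y_def V_def matrix_mult_simps)
  qed
  then have "norm (Y - mat_powr \<rho> (1/2)) = norm (X ** V)" by simp
  also have "\<dots> \<le> sqrt (op_norm R) * (sqrt (op_norm (matrix_inv S)) * norm V)"
  proof -
    have R_bound: "\<bar>l powr (1/2)\<bar> \<le> sqrt (op_norm R)" if "l \<in> real_spectrum R" for l
      using eigenvalue_le_op_norm[OF that] that pd(3) by (auto simp: pos_def_mat_def powr_half_sqrt)
    \<comment> \<open>\<open>1 / l\<close> is an eigenvalue of \<open>matrix_inv S\<close>, hence at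
      most its operator norm.\<close>
    have S_bound: "\<bar>l powr (-1/2)\<bar> \<le> sqrt (op_norm (matrix_inv S))" if l: "l \<in> real_spectrum S" for l
    proof -
      have l0: "l > 0" using l pd(4) by (simp add: pos_def_mat_def)
      obtain v where v: "v \<in> eigenspace S l" "v \<noteq> 0" using real_spectrum_eigenvector[OF l] .
      have "matrix_inv S *v v = (1 / l) *\<^sub>R v"
        using mat_fun_eigenvector[OF herm(4) v(1), of "\<lambda>x. x powr (-1)"] l0
        by (simp add: matrix_inv_eq_mat_powr pd mat_powr_def powr_minus_divide scaleR_eq_smult)
      then have "1 / l \<le> op_norm (matrix_inv S)"
        using norm_matrix_vector_le[of "matrix_inv S" v] v(2) l0 by (simp add: field_simps)
      then have "sqrt (1 / l) \<le> sqrt (op_norm (matrix_inv S))" by simp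
      then show ?thesis
        by (simp only: powr_minus_half[OF l0]) (use l0 in \<open>simp add: real_sqrt_divide\<close>)
    qed
    have op_nonneg: "op_norm A \<ge> 0" for A :: "complex^'n^'n"
      unfolding op_norm_def
      by (intro onorm_pos_le) (simp add: linear_matrix_vector flip: linear_conv_bounded_linear)
    have "norm (X ** V) \<le> sqrt (op_norm R) * norm (mat_powr S (-1/2) ** V)"
      unfolding X_def matrix_mul_assoc[symmetric] mat_powr_def[of R]
      using norm_mult_mat_fun_le(2)[OF herm(3) R_bound] op_nonneg by simp
    also have "\<dots> \<le> sqrt (op_norm R) * (sqrt (op_norm (matrix_inv S)) * norm V)"
      unfolding mat_powr_def[of S]
      using norm_mult_mat_fun_le(2)[OF herm(4) S_bound] op_nonneg by (intro mult_left_mono) auto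
    finally show ?thesis .
  qed
  finally have "2 * norm (Y - mat_powr \<rho> (1/2))
      \<le> 2 * (sqrt (op_norm R) * sqrt (op_norm (matrix_inv S)) * norm V)" by simp
  moreover have "trace_norm (adjoint_mat Y ** Y - \<rho>) \<le> 2 * norm (Y - mat_powr \<rho> (1/2))"
    using trace_norm_diff_squares_le[of Y "mat_powr \<rho> (1/2)"]
    by (simp add: Y1 norm_sqrt_rho adj half pd)
  ultimately show ?thesis unfolding petz V_def by linarith
qed

end

theorem corollary1p8:
  fixes M N :: "(complex^'n^'n) set" and \<rho> \<sigma> \<rho>\<^sub>N \<sigma>\<^sub>N :: "complex^'n^'n"
  assumes "von_neumann_algebra M"
    and "von_neumann_subalgebra N M"
    and "faithful_state M \<rho>"
    and "faithful_state M \<sigma>"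
    and "\<rho>\<^sub>N = cond_exp_tr N \<rho>"
    and "\<sigma>\<^sub>N = cond_exp_tr N \<sigma>"
  shows "relative_entropy \<rho> \<sigma> - relative_entropy \<rho>\<^sub>N \<sigma>\<^sub>N
    \<ge> (pi / 8) ^ 4 * hs_op_norm_on M (rel_modular \<sigma> \<rho>) powi (-2)
        * op_norm \<rho>\<^sub>N powi (-2) * op_norm (matrix_inv \<sigma>\<^sub>N) powi (-2)
        * trace_norm (petz_recovery N \<sigma> \<rho>\<^sub>N - \<rho>) ^ 4"
proof -
  have N: "von_neumann_algebra N" "N \<subseteq> M"
    using assms(2) by (auto simp: von_neumann_subalgebra_def)
  interpret compressed_states M N \<rho> \<sigma> \<rho>\<^sub>N \<sigma>\<^sub>N
    by unfold_locales
      (use assms N faithful_state_pos_def pos_def_cond_exp[OF N(1)] cond_exp_tr_inner[OF N(1)] in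
        \<open>auto simp: faithful_state_def\<close>)
  define a where "a = op_norm \<rho>\<^sub>N"
  define b where "b = op_norm (matrix_inv \<sigma>\<^sub>N)"
  define t where "t = trace_norm (petz_recovery N \<sigma> \<rho>\<^sub>N - \<rho>)"
  define v where "v = norm (mat_powr \<sigma>\<^sub>N (1/2) ** mat_powr \<rho>\<^sub>N (-1/2) ** mat_powr \<rho> (1/2) - mat_powr \<sigma> (1/2))"
  define D where "D = relative_entropy \<rho> \<sigma> - relative_entropy \<rho>\<^sub>N \<sigma>\<^sub>N"
  have ab: "a \<ge> 0" "b \<ge> 0"
    unfolding a_def b_def op_norm_def
    by (intro onorm_pos_le; simp add: linear_matrix_vector flip: linear_conv_bounded_linear)+
  \<comment> \<open>Needed for monotonicity of the fourth power.\<close>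
  have t: "0 \<le> t"
    unfolding t_def petz_recovery_def assms(6)[symmetric]
    by (intro trace_norm_nonneg, unfold hermitian_mat_def)
      (simp add: adjoint_mat_simps hermitian_adjoint hermitian_mat_powr pd herm matrix_mul_assoc)
  have main: "(pi / 4) ^ 4 * v ^ 4 \<le> modular_norm\<^sup>2 * D"
    using entropy_difference_bound by (simp add: v_def D_def)
  have "t \<le> 2 * (sqrt a * sqrt b * v)"
    using trace_norm_recovery_le by (simp add: t_def a_def b_def v_def petz_recovery_def flip: assms(6))
  then have "t ^ 4 \<le> (2 * (sqrt a * sqrt b * v)) ^ 4" using t by (intro power_mono)
  also have "\<dots> = 16 * a\<^sup>2 * b\<^sup>2 * v ^ 4"
  proof -
    have "sqrt c ^ 4 = c\<^sup>2" if "c \<ge> 0" for c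
      using that power_mult[of "sqrt c" 2 2] by simp
    then show ?thesis using ab by (simp add: power_mult_distrib)
  qed
  finally have "(pi / 8) ^ 4 * t ^ 4 \<le> (pi / 8) ^ 4 * (16 * a\<^sup>2 * b\<^sup>2 * v ^ 4)"
    by (intro mult_left_mono) auto
  \<comment> \<open>The factor 16 turns \<open>pi / 8\<close> into \<open>pi / 4\<close> under the
    fourth power.\<close>
  also have "\<dots> = a\<^sup>2 * b\<^sup>2 * ((pi / 4) ^ 4 * v ^ 4)" by (simp add: power_divide)
  also have "\<dots> \<le> a\<^sup>2 * b\<^sup>2 * (modular_norm\<^sup>2 * D)"
    using main by (intro mult_left_mono) auto
  finally have fin: "(pi / 8) ^ 4 * t ^ 4 \<le> a\<^sup>2 * b\<^sup>2 * (modular_norm\<^sup>2 * D)" .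
  have "0 \<le> (pi / 4) ^ 4 * v ^ 4" by simp
  then have "0 \<le> modular_norm\<^sup>2 * D" using main by (rule order_trans)
  then have D0: "0 \<le> D" using modular_norm_pos by (simp add: zero_le_mult_iff)
  have powi: "x powi (-2) = 1 / x\<^sup>2" for x :: real
    using power_int_minus[of x 2] by (simp add: inverse_eq_divide)
  have "(pi / 8) ^ 4 * modular_norm powi (-2) * a powi (-2) * b powi (-2) * t ^ 4
      = ((pi / 8) ^ 4 * t ^ 4) / (a\<^sup>2 * b\<^sup>2 * modular_norm\<^sup>2)"
    unfolding powi by (simp only: times_divide_eq_left times_divide_eq_right divide_divide_eq_left mult_ac mult_1)
  \<comment> \<open>For a zero denominator the quotient is 0 by convention, and \<open>D0\<close>
    settles that case.\<close>
  also have "\<dots> \<le> D"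
  proof (cases "a\<^sup>2 * b\<^sup>2 * modular_norm\<^sup>2 = 0")
    case False
    then have "a\<^sup>2 * b\<^sup>2 * modular_norm\<^sup>2 > 0" by (simp add: less_le)
    moreover have "(pi / 8) ^ 4 * t ^ 4 \<le> D * (a\<^sup>2 * b\<^sup>2 * modular_norm\<^sup>2)"
      using fin by (simp only: mult_ac)
    ultimately show ?thesis by (rule mult_imp_div_pos_le)
  qed (use D0 in auto)
  finally show ?thesis by (simp add: D_def t_def a_def b_def)
qed

end
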